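(* Let $\ell,N_s\ge1$, $L=\ell N_s$, let $\{\mu_k\}_N$ be arbitrary parameters, and let $\varepsilon_1,\dots,\varepsilon_\ell,\varepsilon'_1,\dots,\varepsilon'_\ell\in\{0,1\}$, where $i_1$ is the number of $\alpha$ with $\varepsilon'_\alpha=1$, $j_1$ is the number of $\beta$ with $\varepsilon_\beta=1$, and $i_1-j_1=N-M$. For a given set of Bethe roots $\{\lambda_\gamma\}_M$, the scalar product on the left-hand side below is evaluated through Slavnov's formula of scalar products for the spin-1/2 operators, by means of $$\langle 0|\prod_{k=1}^{N}C^{(\ell;0)}(\mu_k)\cdot e_1^{\varepsilon_1',\varepsilon_1}\cdots e_\ell^{\varepsilon_\ell',\varepsilon_\ell}\cdot\prod_{\gamma=1}^{M}B^{(\ell;0)}(\lambda_\gamma)|0\rangle=\phi_\ell(\{\lambda_\gamma\};\{w_j^{(\ell)}\}_L)$$ $$\times\lim_{\epsilon\to0}\langle 0|\prod_{k=1}^{N}C^{(\ell;\epsilon)}(\mu_k)\cdot T^{(\ell;\epsilon)}_{\varepsilon_1,\varepsilon_1'}(w_1^{(\ell;\epsilon)})\cdots T^{(\ell;\epsilon)}_{\varepsilon_\ell,\varepsilon_\ell'}(w_\ell^{(\ell;\epsilon)})\cdot\prod_{\gamma=1}^{M}B^{(\ell;\epsilon)}(\lambda_\gamma(\epsilon))|0\rangle ,$$ where $\{\lambda_\gamma(\epsilon)\}_M$ satisfy the spin-1/2 Bethe ansatz equations with inhomogeneous parameters given by the almost complete $\ell$-strings, $w_j=w_j^{(\ell;\epsilon)}$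 for $j=1,2,\dots,L$, and $$\phi_m(\{\lambda_\gamma\};\{w_j\}_L)=\prod_{j=1}^{m}\prod_{\gamma=1}^{M}b(\lambda_\gamma-w_j),\qquad b(u)=\sinh(u)/\sinh(u+\eta).$$
   Context: $V^{(1)}=\mathbb C^2$ has basis $|\uparrow\rangle$ (index $0$), $|\downarrow\rangle$ (index $1$); $e^{a,b}$ ($a,b\in\{0,1\}$) is the $2\times2$ matrix with single nonzero entry $1$ at position $(a,b)$; $\sigma^-=e^{1,0}$, $\sigma^+=e^{0,1}$; a subscript $j$ means acting on the $j$th factor of $(V^{(1)})^{\otimes L}$. The vacuum is $|0\rangle=|\uparrow\rangle_1\otimes\cdots\otimes|\uparrow\rangle_L$ and $\langle0|$ is its transpose. $\{x_k\}_n$ denotes a set of parameters $x_1,\dots,x_n$. The symmetric $R$-matrix, with auxiliary space labelled $0$, is, as a $2\times2$ matrix in the auxiliary space with entries acting on site $k$, $$R_{0k}(u)=\begin{pmatrix}\mathrm{diag}(1,b(u)) & c(u)\sigma_k^-\\ c(u)\sigma_k^+&\mathrm{diag}(b(u),1)\end{pmatrix},\quad c(u)=\frac{\sinh\eta}{\sinh(u+\eta)} .$$ The spin-1/2 monodromy matrix with inhomogeneous parameters $w_1,\dots,w_L$ is $T^{(1)}(\lambda;\{w_j\}_L)=R_{0L}(\lambda-w_L)\cdots R_{01}(\lambda-w_1)$. Let $\epsilon$ be infinitesimally small. The $N_s$ sets of almost complete $\ell$-strings are $w^{(\ell;\epsilon)}_{\ell(b-1)+\beta}=\xi_b-(\beta-1)\eta+\epsilon\,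 r_b^{(\beta)}$ for $1\le\beta\le\ell$, $1\le b\le N_s$, where the $r_b^{(\beta)}$ are generic; the complete $\ell$-strings are $w_j^{(\ell)}=w_j^{(\ell;0)}$. Put $T^{(\ell;\epsilon)}(\lambda)=T^{(1)}(\lambda;\{w_j^{(\ell;\epsilon)}\}_L)$ and $T^{(\ell;0)}(\lambda)=\lim_{\epsilon\to0}T^{(\ell;\epsilon)}(\lambda)$, with auxiliary-space entries $T_{\varepsilon,\varepsilon'}(\lambda)$, $\varepsilon,\varepsilon'\in\{0,1\}$; $B=T_{0,1}$ and $C=T_{1,0}$ (with the same superscripts). The spin-1/2 Bethe ansatz equations for $\lambda_1,\dots,\lambda_M$ with inhomogeneous parameters $\{w_j\}_L$ are $$\prod_{j=1}^{L}\frac{\sinh(\lambda_\alpha-w_j+\eta)}{\sinh(\lambda_\alpha-w_j)}=\prod_{\beta\ne\alpha}\frac{\sinh(\lambda_\alpha-\lambda_\beta+\eta)}{\sinh(\lambda_\alpha-\lambda_\beta-\eta)},\qquad \alpha=1,\dots,M.$$ The Bethe roots $\{\lambda_\gamma\}_M$ are a solution of these equations with $w_j=w_j^{(\ell)}$. Slavnov's formula is the determinant formula for the scalar product $\langle0|\prod_{k=1}^{M}C(\mu_k)\prod_{\gamma=1}^{M}B(\lambda_\gamma)|0\rangle$ of spin-1/2 operators when $\{\lambda_\gamma\}_M$ satisfy the Bethe ansatz equations and $\{\mu_k\}_M$ are arbitrary. *)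

theory Defs
  imports Complex_Main "Jordan_Normal_Form.Matrix"
begin

text \<open>
  The space \<open>V\<^sup>\<otimes>\<^sup>L\<close> with \<open>V = \<complex>\<^sup>2\<close> is \<open>\<complex>^(2^L)\<close> with the usual Kronecker numbering of the product
  basis: site 1 is the leftmost tensor factor, i.e. the most significant bit of the index.
  Index 0 (resp. 1) of \<open>V\<close> is spin up (resp. down).
\<close>

definition spin :: "nat \<Rightarrow> nat \<Rightarrow> nat \<Rightarrow> nat" where
  "spin L j p = (p div 2 ^ (L - j)) mod 2"

text \<open>\<open>site_op L j X\<close> is \<open>1 \<otimes> \<dots> \<otimes> X \<otimes> \<dots> \<otimes> 1\<close> with the 2 by 2 matrix \<open>X\<close> in the \<open>j\<close>-th factor.\<close>

definition site_op :: "nat \<Rightarrow> nat \<Rightarrow> complex mat \<Rightarrow> complex mat" where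
  "site_op L j X = mat (2 ^ L) (2 ^ L) (\<lambda>(p, q).
     if \<forall>k\<in>{1..L} - {j}. spin L k p = spin L k q then X $$ (spin L j p, spin L j q) else 0)"

definition elem_mat :: "nat \<Rightarrow> nat \<Rightarrow> complex mat" where
  "elem_mat a b = mat 2 2 (\<lambda>(p, q). if p = a \<and> q = b then 1 else 0)"

definition sigma_minus :: "complex mat" where
  "sigma_minus = elem_mat 1 0"

definition sigma_plus :: "complex mat" where
  "sigma_plus = elem_mat 0 1"

definition b_fun :: "complex \<Rightarrow> complex \<Rightarrow> complex" where
  "b_fun \<eta> u = sinh u / sinh (u + \<eta>)"

definition c_fun :: "complex \<Rightarrow> complex \<Rightarrow> complex" where
  "c_fun \<eta> u = sinh \<eta> / sinh (u + \<eta>)"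

text \<open>\<open>R_entry \<eta> u a a'\<close> is the \<open>(a, a')\<close> entry, with respect to the auxiliary space, of the
  symmetric \<open>R\<close>-matrix; it is a 2 by 2 matrix on the quantum space of one site.\<close>

definition R_entry :: "complex \<Rightarrow> complex \<Rightarrow> nat \<Rightarrow> nat \<Rightarrow> complex mat" where
  "R_entry \<eta> u a a' =
    (if a = 0 \<and> a' = 0 then elem_mat 0 0 + b_fun \<eta> u \<cdot>\<^sub>m elem_mat 1 1
     else if a = 0 then c_fun \<eta> u \<cdot>\<^sub>m sigma_minus
     else if a' = 0 then c_fun \<eta> u \<cdot>\<^sub>m sigma_plus
     else b_fun \<eta> u \<cdot>\<^sub>m elem_mat 0 0 + elem_mat 1 1)"

text \<open>\<open>partial_monodromy L \<eta> w u k\<close> is \<open>R\<^sub>0\<^sub>k(u - w\<^sub>k) \<cdots> R\<^sub>0\<^sub>1(u - w\<^sub>1)\<close>: a product of 2 by 2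
  matrices in the auxiliary space whose entries are operators on the \<open>L\<close> sites.\<close>

primrec partial_monodromy ::
  "nat \<Rightarrow> complex \<Rightarrow> (nat \<Rightarrow> complex) \<Rightarrow> complex \<Rightarrow> nat \<Rightarrow> nat \<Rightarrow> nat \<Rightarrow> complex mat" where
  "partial_monodromy L \<eta> w u 0 a a' = (if a = a' then 1\<^sub>m (2 ^ L) else 0\<^sub>m (2 ^ L) (2 ^ L))"
| "partial_monodromy L \<eta> w u (Suc k) a a' =
     site_op L (Suc k) (R_entry \<eta> (u - w (Suc k)) a 0) * partial_monodromy L \<eta> w u k 0 a'
   + site_op L (Suc k) (R_entry \<eta> (u - w (Suc k)) a 1) * partial_monodromy L \<eta> w u k 1 a'"

definition monodromy ::
  "nat \<Rightarrow> complex \<Rightarrow> (nat \<Rightarrow> complex) \<Rightarrow> complex \<Rightarrow> nat \<Rightarrow> nat \<Rightarrow> complex mat" where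
  "monodromy L \<eta> w u a a' = partial_monodromy L \<eta> w u L a a'"

text \<open>None of the \<open>R\<close>-matrices in the monodromy matrix has a pole at the spectral parameter \<open>u\<close>.\<close>

definition regular_at :: "nat \<Rightarrow> complex \<Rightarrow> (nat \<Rightarrow> complex) \<Rightarrow> complex \<Rightarrow> bool" where
  "regular_at L \<eta> w u \<longleftrightarrow> (\<forall>j\<in>{1..L}. sinh (u - w j + \<eta>) \<noteq> 0)"

text \<open>Almost complete \<open>\<ell>\<close>-strings: site \<open>j = \<ell> (b - 1) + \<beta>\<close> has \<open>b - 1 = (j - 1) div \<ell>\<close> and
  \<open>\<beta> - 1 = (j - 1) mod \<ell>\<close>; the deviation \<open>r\<^sub>b\<^sup>(\<^sup>\<beta>\<^sup>)\<close> is \<open>r b \<beta>\<close>.\<close>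

definition string_param ::
  "nat \<Rightarrow> complex \<Rightarrow> (nat \<Rightarrow> complex) \<Rightarrow> (nat \<Rightarrow> nat \<Rightarrow> complex) \<Rightarrow> real \<Rightarrow> nat \<Rightarrow> complex" where
  "string_param l \<eta> \<xi> r \<epsilon> j =
     \<xi> ((j - 1) div l + 1) - of_nat ((j - 1) mod l) * \<eta>
       + of_real \<epsilon> * r ((j - 1) div l + 1) ((j - 1) mod l + 1)"

lemma string_param_index:
  assumes "1 \<le> b" "1 \<le> \<beta>" "\<beta> \<le> l"
  shows "string_param l \<eta> \<xi> r \<epsilon> (l * (b - 1) + \<beta>)
       = \<xi> b - (of_nat \<beta> - 1) * \<eta> + of_real \<epsilon> * r b \<beta>"
proof -
  obtain c where c: "\<beta> = Suc c" using assms by (cases \<beta>) auto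
  obtain a where a: "b = Suc a" using assms by (cases b) auto
  have "c < l" using assms c by simp
  then show ?thesis by (simp add: string_param_def a c)
qed

definition T_eps ::
  "nat \<Rightarrow> nat \<Rightarrow> complex \<Rightarrow> (nat \<Rightarrow> complex) \<Rightarrow> (nat \<Rightarrow> nat \<Rightarrow> complex) \<Rightarrow> real \<Rightarrow>
   complex \<Rightarrow> nat \<Rightarrow> nat \<Rightarrow> complex mat" where
  "T_eps l Ns \<eta> \<xi> r \<epsilon> u a a' = monodromy (l * Ns) \<eta> (string_param l \<eta> \<xi> r \<epsilon>) u a a'"

text \<open>\<open>T\<^sup>(\<^sup>\<ell>\<^sup>;\<^sup>0\<^sup>)\<close> is the entrywise limit \<open>\<epsilon> \<rightarrow> 0\<close> at fixed spectral parameter.\<close>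

definition T_zero ::
  "nat \<Rightarrow> nat \<Rightarrow> complex \<Rightarrow> (nat \<Rightarrow> complex) \<Rightarrow> (nat \<Rightarrow> nat \<Rightarrow> complex) \<Rightarrow>
   complex \<Rightarrow> nat \<Rightarrow> nat \<Rightarrow> complex mat" where
  "T_zero l Ns \<eta> \<xi> r u a a' = mat (2 ^ (l * Ns)) (2 ^ (l * Ns))
     (\<lambda>(p, q). Lim (at (0::real)) (\<lambda>\<epsilon>. T_eps l Ns \<eta> \<xi> r \<epsilon> u a a' $$ (p, q)))"

definition B_eps where "B_eps l Ns \<eta> \<xi> r \<epsilon> u = T_eps l Ns \<eta> \<xi> r \<epsilon> u 0 1"
definition C_eps where "C_eps l Ns \<eta> \<xi> r \<epsilon> u = T_eps l Ns \<eta> \<xi> r \<epsilon> u 1 0"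
definition B_zero where "B_zero l Ns \<eta> \<xi> r u = T_zero l Ns \<eta> \<xi> r u 0 1"
definition C_zero where "C_zero l Ns \<eta> \<xi> r u = T_zero l Ns \<eta> \<xi> r u 1 0"

definition op_prod :: "nat \<Rightarrow> nat \<Rightarrow> (nat \<Rightarrow> complex mat) \<Rightarrow> complex mat" where
  "op_prod L n X = foldr (*) (map X [1..<Suc n]) (1\<^sub>m (2 ^ L))"

definition vacuum :: "nat \<Rightarrow> complex vec" where
  "vacuum L = unit_vec (2 ^ L) 0"

text \<open>\<open>\<langle>0|X|0\<rangle>\<close>; the bra is the transpose of the ket and \<open>\<bullet>\<close> is bilinear.\<close>

definition vev :: "nat \<Rightarrow> complex mat \<Rightarrow> complex" where
  "vev L X = vacuum L \<bullet> (X *\<^sub>v vacuum L)"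

text \<open>
  A set of \<open>M\<close> Bethe roots for the inhomogeneous parameters \<open>w\<^sub>1, \<dots>, w\<^sub>L\<close>.
  The roots are pairwise distinct (modulo the period \<open>i\<pi>\<close> of the equations), and all denominators
  in the equations are nonzero, so that the conventional value of division by zero plays no role.
\<close>

definition bethe_roots ::
  "nat \<Rightarrow> complex \<Rightarrow> (nat \<Rightarrow> complex) \<Rightarrow> nat \<Rightarrow> (nat \<Rightarrow> complex) \<Rightarrow> bool" where
  "bethe_roots L \<eta> w M v \<longleftrightarrow>
     (\<forall>\<alpha>\<in>{1..M}. \<forall>\<beta>\<in>{1..M} - {\<alpha>}. sinh (v \<alpha> - v \<beta>) \<noteq> 0 \<and> sinh (v \<alpha> - v \<beta> - \<eta>) \<noteq> 0) \<and>
     (\<forall>\<alpha>\<in>{1..M}. \<forall>j\<in>{1..L}. sinh (v \<alpha> - w j) \<noteq> 0) \<and>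
     (\<forall>\<alpha>\<in>{1..M}.
        (\<Prod>j=1..L. sinh (v \<alpha> - w j + \<eta>) / sinh (v \<alpha> - w j))
      = (\<Prod>\<beta>\<in>{1..M} - {\<alpha>}. sinh (v \<alpha> - v \<beta> + \<eta>) / sinh (v \<alpha> - v \<beta> - \<eta>)))"

definition phi :: "complex \<Rightarrow> nat \<Rightarrow> nat \<Rightarrow> (nat \<Rightarrow> complex) \<Rightarrow> (nat \<Rightarrow> complex) \<Rightarrow> complex" where
  "phi \<eta> m M v w = (\<Prod>j=1..m. \<Prod>\<gamma>=1..M. b_fun \<eta> (v \<gamma> - w j))"

end

theory Submission
  imports Defs
begin

text \<open>
  At a site parameter the \<open>R\<close>-matrix of that site degenerates to a permutation. For the first site this gives
  \<open>T\<^bsub>\<epsilon>,\<epsilon>'\<^esub>(w\<^sub>1) = e\<^sub>1\<^bsup>\<epsilon>',\<epsilon>\<^esup> t(w\<^sub>1)\<close> with the transfer matrix \<open>t = A + D\<close>, and multiplication by \<open>t(w\<^sub>1)\<close> moves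
  the first site to the end of the chain. Iterating, the product of \<open>T\<^bsub>\<epsilon>\<^sub>\<alpha>,\<epsilon>'\<^sub>\<alpha>\<^esub>(w\<^sub>\<alpha>)\<close> over \<open>\<alpha> \<le> \<ell>\<close> is the product of
  local operators times \<open>t(w\<^sub>1) \<cdots> t(w\<^sub>\<ell>)\<close>; no transfer matrix has to be inverted. On a Bethe vector \<open>t(w\<^sub>\<alpha>)\<close>
  has the eigenvalue \<open>\<Prod>\<^sub>\<gamma> 1 / b(\<lambda>\<^sub>\<gamma> - w\<^sub>\<alpha>)\<close>, because \<open>D\<close> vanishes on the vacuum there. So the identity holds exactly
  for almost complete strings with small nonzero deviation: the genericity of the \<open>r\<^sub>b\<^sup>(\<^sup>\<beta>\<^sup>)\<close> keeps all \<open>T(w\<^sub>\<alpha>)\<close>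
  free of poles. The poles of \<open>T(w\<^sub>\<alpha>)\<close> in the limit cancel, as the side with the local operators is
  continuous at complete strings and the factor \<open>\<phi>\<^sub>\<ell>\<close> has a nonzero limit.
\<close>

section \<open>Exchange relations\<close>

text \<open>Clearing the denominator \<open>sinh (x + \<eta>)\<close> lets the exchange relation be
  stated for every difference x of spectral parameters, also where R itself has a pole.\<close>

definition r_diag :: "complex \<Rightarrow> complex \<Rightarrow> bool \<Rightarrow> bool \<Rightarrow> complex" where
  "r_diag \<eta> x a b = (if a = b then sinh (x + \<eta>) else sinh x)"

definition r_flip :: "complex \<Rightarrow> bool \<Rightarrow> bool \<Rightarrow> complex" where
  "r_flip \<eta> a b = (if a = b then 0 else sinh \<eta>)"

text \<open>A 2 by 2 matrix in the auxiliary space with entries in a ring is a function of two Booleans;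
  \<open>False\<close> stands for the index 0 (spin up) and \<open>True\<close> for 1.\<close>

definition commute_on :: "(bool \<Rightarrow> bool \<Rightarrow> 'a::ring_1) \<Rightarrow> (bool \<Rightarrow> bool \<Rightarrow> 'a) \<Rightarrow> bool" where
  "commute_on X Y \<longleftrightarrow> (\<forall>a b c d. X a b * Y c d = Y c d * X a b)"

definition aux_mult :: "(bool \<Rightarrow> bool \<Rightarrow> 'a::ring_1) \<Rightarrow> (bool \<Rightarrow> bool \<Rightarrow> 'a) \<Rightarrow> bool \<Rightarrow> bool \<Rightarrow> 'a"
  where "aux_mult X Y a b = (\<Sum>c\<in>UNIV. X a c * Y c b)"

definition aux_one :: "bool \<Rightarrow> bool \<Rightarrow> 'a::ring_1" where
  "aux_one a b = (if a = b then 1 else 0)"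

lemma aux_mult_one [simp]: "aux_mult X aux_one = X" "aux_mult aux_one X = X"
  by (auto simp: aux_mult_def aux_one_def UNIV_bool fun_eq_iff)

lemma aux_mult_assoc: "aux_mult (aux_mult X Y) Z = aux_mult X (aux_mult Y Z)"
  by (simp add: aux_mult_def UNIV_bool fun_eq_iff distrib_left distrib_right mult.assoc add_ac)

lemma commute_on_sym: "commute_on X Y \<Longrightarrow> commute_on Y X"
  by (simp add: commute_on_def)

lemma commute_on_one: "commute_on X aux_one"
  by (simp add: commute_on_def aux_one_def)

lemma commute_on_mult:
  assumes "commute_on X Y" "commute_on X Z"
  shows "commute_on X (aux_mult Y Z)"
  using assms unfolding commute_on_def aux_mult_def UNIV_bool
  by (auto simp: distrib_left distrib_right) (metis mult.assoc)+

locale complex_algebra = vector_space scale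
  for scale :: "complex \<Rightarrow> 'a::ring_1 \<Rightarrow> 'a" (infixr "\<odot>" 75) +
  assumes scale_mult_left: "(c \<odot> x) * y = c \<odot> (x * y)"
    and scale_mult_right: "x * (c \<odot> y) = c \<odot> (x * y)"
begin

text \<open>The exchange relation \<open>R\<^sub>1\<^sub>2(x) X\<^sub>1 Y\<^sub>2 = Y\<^sub>2 X\<^sub>1 R\<^sub>1\<^sub>2(x)\<close> in components, where \<open>R\<close> is
  multiplied by \<open>sinh (x + \<eta>)\<close>: its entries are \<open>r_diag\<close> at \<open>(a b, a b)\<close> and \<open>r_flip\<close> at \<open>(a b, b a)\<close>.\<close>

definition rtt :: "complex \<Rightarrow> complex \<Rightarrow> (bool \<Rightarrow> bool \<Rightarrow> 'a) \<Rightarrow> (bool \<Rightarrow> bool \<Rightarrow> 'a) \<Rightarrow> bool" where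
  "rtt \<eta> x X Y \<longleftrightarrow> (\<forall>a b a' b'.
     r_diag \<eta> x a b \<odot> (X a a' * Y b b') + r_flip \<eta> a b \<odot> (X b a' * Y a b')
   = r_diag \<eta> x a' b' \<odot> (Y b b' * X a a') + r_flip \<eta> a' b' \<odot> (Y b a' * X a b'))"

lemma rtt_one: "rtt \<eta> x aux_one aux_one"
  by (auto simp: rtt_def aux_one_def r_diag_def r_flip_def)

text \<open>R is pulled first through X and X', then through Y and Y'. The commutation hypotheses,
  which hold for factors on different sites, allow the products to be regrouped in this way.\<close>

lemma rtt_mult:
  assumes X: "rtt \<eta> x X X'" and Y: "rtt \<eta> x Y Y'"
    and c: "commute_on X' Y" "commute_on X Y'"
  shows "rtt \<eta> x (aux_mult X Y) (aux_mult X' Y')"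
  unfolding rtt_def
proof (intro allI)
  fix a b a' b'
  have c1: "(p * Y e g) * (X' i j * q) = p * X' i j * (Y e g * q)" for p q e g i j
    using c(1) by (simp add: commute_on_def) (metis mult.assoc)
  have c2: "(p * Y' e g) * (X i j * q) = p * X i j * (Y' e g * q)" for p q e g i j
    using c(2) by (simp add: commute_on_def) (metis mult.assoc)
  have m1: "aux_mult X Y i a' * aux_mult X' Y' j b'
      = (\<Sum>e\<in>UNIV. \<Sum>f\<in>UNIV. X i e * X' j f * (Y e a' * Y' f b'))" for i j a' b'
    by (simp add: aux_mult_def sum_product c1)
  have m2: "aux_mult X' Y' j a' * aux_mult X Y i b'
      = (\<Sum>e\<in>UNIV. \<Sum>f\<in>UNIV. X' j f * X i e * (Y' f a' * Y e b'))" for i j a' b'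
    by (subst sum.swap) (simp add: aux_mult_def sum_product c2)
  have "r_diag \<eta> x a b \<odot> (aux_mult X Y a a' * aux_mult X' Y' b b')
      + r_flip \<eta> a b \<odot> (aux_mult X Y b a' * aux_mult X' Y' a b')
    = (\<Sum>e\<in>UNIV. \<Sum>f\<in>UNIV. (r_diag \<eta> x a b \<odot> (X a e * X' b f)
        + r_flip \<eta> a b \<odot> (X b e * X' a f)) * (Y e a' * Y' f b'))"
    by (simp add: m1 scale_sum_right sum.distrib distrib_right scale_mult_left)
  also have "\<dots> = (\<Sum>e\<in>UNIV. \<Sum>f\<in>UNIV. (r_diag \<eta> x e f \<odot> (X' b f * X a e)
        + r_flip \<eta> e f \<odot> (X' b e * X a f)) * (Y e a' * Y' f b'))"
    using X by (simp add: rtt_def)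
  also have "\<dots> = (\<Sum>e\<in>UNIV. \<Sum>f\<in>UNIV. (r_diag \<eta> x e f \<odot> (X' b f * X a e)) * (Y e a' * Y' f b'))
       + (\<Sum>e\<in>UNIV. \<Sum>f\<in>UNIV. (r_flip \<eta> e f \<odot> (X' b e * X a f)) * (Y e a' * Y' f b'))"
    by (simp add: sum.distrib distrib_right)
  \<comment> \<open>Exchanging the names e and f in the flip term, where \<open>r_flip\<close> is
    symmetric, gives both terms the common left factor \<open>X' b f * X a e\<close>.\<close>
  also have "(\<Sum>e\<in>UNIV. \<Sum>f\<in>UNIV. (r_flip \<eta> e f \<odot> (X' b e * X a f)) * (Y e a' * Y' f b'))
      = (\<Sum>e\<in>UNIV. \<Sum>f\<in>UNIV. (r_flip \<eta> e f \<odot> (X' b f * X a e)) * (Y f a' * Y' e b'))"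
    by (subst sum.swap) (simp add: r_flip_def eq_commute)
  also have "(\<Sum>e\<in>UNIV. \<Sum>f\<in>UNIV. (r_diag \<eta> x e f \<odot> (X' b f * X a e)) * (Y e a' * Y' f b')) + \<dots>
      = (\<Sum>e\<in>UNIV. \<Sum>f\<in>UNIV. (X' b f * X a e) *
          (r_diag \<eta> x e f \<odot> (Y e a' * Y' f b') + r_flip \<eta> e f \<odot> (Y f a' * Y' e b')))"
    by (simp add: sum.distrib distrib_left scale_mult_left scale_mult_right)
  also have "\<dots> = (\<Sum>e\<in>UNIV. \<Sum>f\<in>UNIV. (X' b f * X a e) *
          (r_diag \<eta> x a' b' \<odot> (Y' f b' * Y e a') + r_flip \<eta> a' b' \<odot> (Y' f a' * Y e b')))"
    using Y by (simp add: rtt_def)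
  also have "\<dots> = r_diag \<eta> x a' b' \<odot> (aux_mult X' Y' b b' * aux_mult X Y a a')
      + r_flip \<eta> a' b' \<odot> (aux_mult X' Y' b a' * aux_mult X Y a b')"
    by (simp add: m2 scale_sum_right sum.distrib distrib_left scale_mult_right)
  finally show "r_diag \<eta> x a b \<odot> (aux_mult X Y a a' * aux_mult X' Y' b b')
      + r_flip \<eta> a b \<odot> (aux_mult X Y b a' * aux_mult X' Y' a b')
    = r_diag \<eta> x a' b' \<odot> (aux_mult X' Y' b b' * aux_mult X Y a a')
      + r_flip \<eta> a' b' \<odot> (aux_mult X' Y' b a' * aux_mult X Y a b')" .
qed

end

text \<open>The \<open>(p, q)\<close> entry, on the quantum space, of the \<open>(a, a')\<close> entry, in the auxiliary space, of
  the \<open>R\<close>-matrix.\<close>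

definition lax_coeff :: "complex \<Rightarrow> complex \<Rightarrow> bool \<Rightarrow> bool \<Rightarrow> bool \<Rightarrow> bool \<Rightarrow> complex" where
  "lax_coeff \<eta> u a a' p q =
     (if a = a' then (if p = q then (if p = a then 1 else b_fun \<eta> u) else 0)
      else (if p = a' \<and> q = a then c_fun \<eta> u else 0))"

text \<open>The exchange relation for one site, i.e. the Yang-Baxter equation with the quantum space
  as third space, reduced to scalars. Here u and v are already shifted by the site
  parameter.\<close>

lemma lax_coeff_yang_baxter:
  assumes u: "sinh (u + \<eta>) \<noteq> 0" and v: "sinh (v + \<eta>) \<noteq> 0"
  shows "r_diag \<eta> (u - v) a b * (\<Sum>m\<in>UNIV. lax_coeff \<eta> u a a' p m * lax_coeff \<eta> v b b' m q)
       + r_flip \<eta> a b * (\<Sum>m\<in>UNIV. lax_coeff \<eta> u b a' p m * lax_coeff \<eta> v a b' m q)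
       = r_diag \<eta> (u - v) a' b' * (\<Sum>m\<in>UNIV. lax_coeff \<eta> v b b' p m * lax_coeff \<eta> u a a' m q)
       + r_flip \<eta> a' b' * (\<Sum>m\<in>UNIV. lax_coeff \<eta> v b a' p m * lax_coeff \<eta> u a b' m q)"
proof -
  \<comment> \<open>Once denominators are cleared, the components follow from these three addition
    formulas, oriented as rewrite rules; \<open>i3'\<close> is the third with a further factor in
    the middle.\<close>
  have i1: "sinh u * sinh (\<eta> + u - v) = sinh \<eta> * sinh v + sinh (u - v) * sinh (\<eta> + u)"
    and i2: "sinh (\<eta> + v) * sinh (\<eta> + u - v) = sinh \<eta> * sinh (\<eta> + u) + sinh v * sinh (u - v)"
    and i3: "sinh u * sinh (\<eta> + v) = sinh \<eta> * sinh (u - v) + sinh v * sinh (\<eta> + u)"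
    by (simp_all add: sinh_field_def exp_add exp_diff exp_minus field_simps)
  have i3': "sinh u * (z * sinh (\<eta> + v)) = z * (sinh \<eta> * sinh (u - v) + sinh v * sinh (\<eta> + u))" for z
    by (simp add: i3[symmetric] mult_ac)
  note [simp] = UNIV_bool r_diag_def r_flip_def lax_coeff_def b_fun_def c_fun_def
  have d: "sinh (\<eta> + u) \<noteq> 0" "sinh (\<eta> + v) \<noteq> 0"
    using u v by (simp_all add: add.commute)
  show ?thesis
    by (cases a; cases b; cases a'; cases b'; cases p; cases q; insert d; simp add: field_simps)
      (simp_all add: i1 i2 i3 i3' algebra_simps)
qed

section \<open>Chains of sites\<close>

text \<open>Only the relations of matrix units are kept, so that the sites can be arranged in any
  order, as the cyclic moves require.\<close>

locale spin_chain = complex_algebra scale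
  for scale :: "complex \<Rightarrow> 'a::ring_1 \<Rightarrow> 'a" (infixr "\<odot>" 75) +
  fixes sites :: "nat set" and E :: "nat \<Rightarrow> bool \<Rightarrow> bool \<Rightarrow> 'a"
    and \<eta> :: complex and w :: "nat \<Rightarrow> complex"
  assumes E_mult: "j \<in> sites \<Longrightarrow> E j a b * E j c d = (if b = c then E j a d else 0)"
    and E_commute: "j \<in> sites \<Longrightarrow> k \<in> sites \<Longrightarrow> j \<noteq> k \<Longrightarrow> commute_on (E j) (E k)"
    and sinh_eta: "sinh \<eta> \<noteq> 0"
begin

definition lax :: "nat \<Rightarrow> complex \<Rightarrow> bool \<Rightarrow> bool \<Rightarrow> 'a" where
  "lax j u a b = (\<Sum>p\<in>UNIV. \<Sum>q\<in>UNIV. lax_coeff \<eta> (u - w j) a b p q \<odot> E j p q)"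

text \<open>The head of the list is the site whose \<open>R\<close>-matrix stands rightmost in the product.\<close>

primrec chain :: "nat list \<Rightarrow> complex \<Rightarrow> bool \<Rightarrow> bool \<Rightarrow> 'a" where
  "chain [] u = aux_one"
| "chain (x # xs) u = aux_mult (chain xs u) (lax x u)"

definition tau :: "nat list \<Rightarrow> complex \<Rightarrow> 'a" where
  "tau xs u = (\<Sum>a\<in>UNIV. chain xs u a a)"

definition reg :: "nat list \<Rightarrow> complex \<Rightarrow> bool" where
  "reg xs u \<longleftrightarrow> (\<forall>x\<in>set xs. sinh (u - w x + \<eta>) \<noteq> 0)"

lemma reg_simps [simp]:
  "reg [] u"
  "reg (x # xs) u \<longleftrightarrow> sinh (u - w x + \<eta>) \<noteq> 0 \<and> reg xs u"
  "reg (xs @ ys) u \<longleftrightarrow> reg xs u \<and> reg ys u"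
  by (auto simp: reg_def)

lemma chain_append: "chain (xs @ ys) u = aux_mult (chain ys u) (chain xs u)"
  by (induction xs) (simp_all add: aux_mult_assoc)

lemma commute_on_lax: "commute_on X (E j) \<Longrightarrow> commute_on X (lax j u)"
  by (simp add: commute_on_def lax_def sum_distrib_left sum_distrib_right
      scale_mult_left scale_mult_right)

lemma commute_on_chain:
  "(\<And>x. x \<in> set xs \<Longrightarrow> commute_on X (E x)) \<Longrightarrow> commute_on X (chain xs u)"
  by (induction xs) (auto intro!: commute_on_one commute_on_mult commute_on_lax)

lemma chain_commute_E:
  assumes "set xs \<subseteq> sites" "j \<in> sites" "j \<notin> set xs"
  shows "commute_on (E j) (chain xs u)"
  using assms by (intro commute_on_chain E_commute) auto

text \<open>The matrix units of one site collapse, so multiplication in the quantum space becomes a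
  scalar matrix product and \<open>lax_coeff_yang_baxter\<close> applies coefficient by
  coefficient.\<close>

lemma lax_mult:
  assumes "j \<in> sites"
  shows "lax j u a a' * lax j v b b' = (\<Sum>p\<in>UNIV. \<Sum>q\<in>UNIV.
     (\<Sum>m\<in>UNIV. lax_coeff \<eta> (u - w j) a a' p m * lax_coeff \<eta> (v - w j) b b' m q) \<odot> E j p q)"
  using assms by (simp add: lax_def UNIV_bool distrib_left distrib_right scale_mult_left
      scale_mult_right E_mult scale_left_distrib scale_right_distrib mult.commute add_ac)

lemma rtt_lax:
  assumes "j \<in> sites" "sinh (u - w j + \<eta>) \<noteq> 0" "sinh (v - w j + \<eta>) \<noteq> 0"
  shows "rtt \<eta> (u - v) (lax j u) (lax j v)"
  unfolding rtt_def
proof (intro allI)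
  fix a b a' b'
  have *: "u - v = (u - w j) - (v - w j)" by simp
  show "r_diag \<eta> (u - v) a b \<odot> (lax j u a a' * lax j v b b')
      + r_flip \<eta> a b \<odot> (lax j u b a' * lax j v a b')
      = r_diag \<eta> (u - v) a' b' \<odot> (lax j v b b' * lax j u a a')
      + r_flip \<eta> a' b' \<odot> (lax j v b a' * lax j u a b')"
    unfolding lax_mult[OF assms(1)] scale_sum_right scale_scale sum.distrib[symmetric]
      scale_left_distrib[symmetric]
    unfolding * lax_coeff_yang_baxter[OF assms(2,3)] ..
qed

lemma rtt_chain:
  "distinct xs \<Longrightarrow> set xs \<subseteq> sites \<Longrightarrow> reg xs u \<Longrightarrow> reg xs v \<Longrightarrow>
   rtt \<eta> (u - v) (chain xs u) (chain xs v)"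
proof (induction xs)
  case (Cons x xs)
  have "commute_on (chain xs s) (lax x t)" for s t
    using Cons.prems by (intro commute_on_lax commute_on_sym[OF chain_commute_E]) auto
  with Cons show ?case by (auto intro!: rtt_mult rtt_lax)
qed (simp add: rtt_one)

section \<open>Transfer matrices at the site parameters\<close>

text \<open>\<open>b_fun \<eta> 0 = 0\<close> and, because \<open>sinh \<eta> \<noteq> 0\<close>,
  \<open>c_fun \<eta> 0 = 1\<close>: the R-matrix is the permutation of the auxiliary space and the
  site.\<close>

lemma lax_at_site: "lax j (w j) a b = E j b a"
  using sinh_eta by (cases a; cases b) (simp_all add: lax_def UNIV_bool lax_coeff_def b_fun_def c_fun_def)

text \<open>The rightmost R-matrix is a permutation, so the left side is the sum over c of
  \<open>chain xs (w x) a c * E x b c\<close>. In the trace on the right the factor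
  \<open>E x b a\<close> keeps exactly the row a.\<close>

lemma chain_at_head:
  assumes "distinct (x # xs)" "set (x # xs) \<subseteq> sites"
  shows "chain (x # xs) (w x) a b = E x b a * tau (x # xs) (w x)"
proof -
  have "E x i j * chain xs u a b = chain xs u a b * E x i j" for i j u a b
    using chain_commute_E[of xs x u] assms by (simp add: commute_on_def)
  then have c: "E x i j * (chain xs u a b * z) = chain xs u a b * (E x i j * z)" for i j u a b z
    by (simp flip: mult.assoc)
  show ?thesis
    using assms by (cases a) (simp_all add: tau_def aux_mult_def lax_at_site UNIV_bool distrib_left c E_mult)
qed

text \<open>Both sides expand into the matrix units of site \<open>x\<close>, and comparing coefficients leaves
  the exchange relations of the chain without \<open>x\<close>.\<close>

lemma tau_cycle:
  assumes xs: "distinct (x # xs)" "set (x # xs) \<subseteq> sites"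
    and reg: "reg (x # xs) u" "reg xs (w x)"
  shows "tau (x # xs) (w x) * chain (x # xs) u a b = chain (xs @ [x]) u a b * tau (x # xs) (w x)"
proof -
  define X where "X = chain xs u"
  define Y where "Y = chain xs (w x)"
  \<comment> \<open>These are the entries of one R-matrix met twice: as the operator on site x and,
    up to the factor \<open>sinh (u - w x + \<eta>)\<close>, in the exchange relation of X and Y.
    Both have the argument \<open>u - w x\<close>, and this coincidence makes the move
    possible.\<close>
  define \<rho> where "\<rho> a b = lax_coeff \<eta> (u - w x) a a b b" for a b
  define \<sigma> where "\<sigma> a b = (if a = b then 0 else c_fun \<eta> (u - w x))" for a b :: bool
  have x: "x \<in> sites" "x \<notin> set xs" "set xs \<subseteq> sites" using xs by auto
  have c: "E x i j * X a b = X a b * E x i j" "E x i j * Y a b = Y a b * E x i j" for i j a b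
    using chain_commute_E[OF x(3,1,2)] unfolding X_def Y_def commute_on_def by auto
  have c': "E x i j * (X a b * z) = X a b * (E x i j * z)"
    "E x i j * (Y a b * z) = Y a b * (E x i j * z)" for i j a b z
    by (simp_all add: c mult.assoc[symmetric])
  have lax_c: "lax x u i j * (X k l * (Y p q * z)) = X k l * (Y p q * (lax x u i j * z))"
    for i j k l p q z
    by (simp add: lax_def sum_distrib_left sum_distrib_right scale_mult_left scale_mult_right
        mult.assoc c')
  have rtt: "rtt \<eta> (u - w x) X Y"
    unfolding X_def Y_def using xs reg by (intro rtt_chain) auto
  have s: "sinh (u - w x + \<eta>) \<noteq> 0" using reg by simp
  have r: "r_diag \<eta> (u - w x) i j = sinh (u - w x + \<eta>) * \<rho> i j"
    "r_flip \<eta> i j = sinh (u - w x + \<eta>) * \<sigma> i j" for i j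
    using s by (auto simp: r_diag_def r_flip_def \<rho>_def \<sigma>_def lax_coeff_def b_fun_def c_fun_def)
  have key: "\<rho> a c \<odot> (X a b * Y c q) + \<sigma> a c \<odot> (X c b * Y a q)
      = \<rho> b q \<odot> (Y c q * X a b) + \<sigma> b q \<odot> (Y c b * X a q)" for c q
  proof -
    have "sinh (u - w x + \<eta>) \<odot> (\<rho> a c \<odot> (X a b * Y c q) + \<sigma> a c \<odot> (X c b * Y a q))
      = sinh (u - w x + \<eta>) \<odot> (\<rho> b q \<odot> (Y c q * X a b) + \<sigma> b q \<odot> (Y c b * X a q))"
      using rtt by (simp add: rtt_def r scale_right_distrib)
    then show ?thesis using s scale_left_imp_eq by blast
  qed
  have t: "tau (x # xs) (w x) = (\<Sum>c\<in>UNIV. \<Sum>d\<in>UNIV. Y c d * E x c d)"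
    by (simp add: tau_def aux_mult_def lax_at_site Y_def)
  have E_lax: "E x c d * lax x u k b = (\<Sum>q\<in>UNIV. lax_coeff \<eta> (u - w x) k b d q \<odot> E x c q)" for c d k
    using x by (cases d) (simp_all add: lax_def UNIV_bool distrib_left scale_mult_right E_mult)
  have lax_E: "lax x u a k * E x c d = (\<Sum>p\<in>UNIV. lax_coeff \<eta> (u - w x) a k p c \<odot> E x p d)" for c d k
    using x by (cases c) (simp_all add: lax_def UNIV_bool distrib_right scale_mult_left E_mult)
  have "tau (x # xs) (w x) * chain (x # xs) u a b
      = (\<Sum>k\<in>UNIV. \<Sum>c\<in>UNIV. \<Sum>d\<in>UNIV. Y c d * (X a k * (E x c d * lax x u k b)))"
    by (simp add: t aux_mult_def X_def[symmetric] sum_distrib_left sum_distrib_right mult.assoc c')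
  also have "\<dots> = (\<Sum>c\<in>UNIV. \<Sum>q\<in>UNIV. (\<rho> b q \<odot> (Y c q * X a b) + \<sigma> b q \<odot> (Y c b * X a q)) * E x c q)"
    unfolding E_lax by (cases b) (simp_all add: UNIV_bool \<rho>_def \<sigma>_def lax_coeff_def
        distrib_left distrib_right scale_mult_left scale_mult_right mult.assoc add_ac)
  also have "\<dots> = (\<Sum>c\<in>UNIV. \<Sum>q\<in>UNIV. (\<rho> a c \<odot> (X a b * Y c q) + \<sigma> a c \<odot> (X c b * Y a q)) * E x c q)"
    by (simp only: key)
  also have "\<dots> = (\<Sum>c\<in>UNIV. \<Sum>d\<in>UNIV. \<Sum>k\<in>UNIV. X k b * (Y c d * (lax x u a k * E x c d)))"
    unfolding lax_E by (cases a) (simp_all add: UNIV_bool \<rho>_def \<sigma>_def lax_coeff_def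
        distrib_left distrib_right scale_mult_left scale_mult_right mult.assoc add_ac)
  also have "\<dots> = (\<Sum>c\<in>UNIV. \<Sum>d\<in>UNIV. \<Sum>k\<in>UNIV. lax x u a k * (X k b * (Y c d * E x c d)))"
    by (simp add: lax_c)
  also have "\<dots> = chain (xs @ [x]) u a b * tau (x # xs) (w x)"
    by (simp add: t chain_append aux_mult_def X_def[symmetric] sum_distrib_left sum_distrib_right mult.assoc)
  finally show ?thesis .
qed

end

section \<open>Algebraic Bethe ansatz\<close>

text \<open>In the induction for \<open>bethe_expansion\<close> the unwanted term of an older root
  arises twice, directly and after an exchange of spectral parameters. By an addition formula the
  two coefficients merge into one product.\<close>

lemma bethe_coeff_identity:
  fixes k i u h :: complex
  assumes "sinh (k - u) \<noteq> 0" "sinh (i - u) \<noteq> 0" "sinh (k - i) \<noteq> 0"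
  shows "sinh (k - u + h) / sinh (k - u) * (sinh h / sinh (i - u))
       - sinh h / sinh (k - u) * (sinh h / sinh (i - k))
       = sinh h / sinh (i - u) * (sinh (k - i + h) / sinh (k - i))"
proof -
  have s: "sinh (i - k) = - sinh (k - i)" by (metis minus_diff_eq sinh_minus)
  have "sinh (k - u + h) * sinh (k - i) + sinh h * sinh (i - u) = sinh (k - i + h) * sinh (k - u)"
    by (simp add: sinh_field_def exp_add exp_diff exp_minus field_simps)
  moreover have "p / x * (h' / y) - h' / x * (h' / - z) = h' / y * (t / z)"
    if "p * z + h' * y = t * x" "x \<noteq> 0" "y \<noteq> 0" "z \<noteq> 0" for p x h' y z t :: complex
  proof -
    have "p / x * (h' / y) - h' / x * (h' / - z) = h' * (p * z + h' * y) / (x * y * z)"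
      using that(2-) by (simp add: field_simps)
    also have "\<dots> = h' / y * (t / z)"
      using that by simp
    finally show ?thesis .
  qed
  ultimately show ?thesis using assms unfolding s by blast
qed

context complex_algebra
begin

text \<open>With \<open>h = \<eta>\<close> this is the action of \<open>A\<close> on a Bethe vector, with \<open>h = - \<eta>\<close> that of \<open>D\<close>. The vacuum
  is represented by an element \<open>\<Omega>\<close> of the algebra, so that Bethe vectors lie in the left ideal it generates.\<close>

lemma bethe_expansion:
  fixes X B :: "complex \<Rightarrow> 'a" and ev :: "complex \<Rightarrow> complex" and v :: "'i \<Rightarrow> complex"
  assumes XB: "\<And>x y. x \<in> G \<Longrightarrow> y \<in> G \<Longrightarrow>
      sinh (y - x) \<odot> (X x * B y) = sinh (y - x + h) \<odot> (B y * X x) - sinh h \<odot> (B x * X y)"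
    and BB: "\<And>x y. x \<in> G \<Longrightarrow> y \<in> G \<Longrightarrow> B x * B y = B y * B x"
    and vac: "\<And>x. x \<in> G \<Longrightarrow> X x * \<Omega> = ev x \<odot> \<Omega>"
  shows "distinct is \<Longrightarrow> u \<in> G \<Longrightarrow> v ` set is \<subseteq> G \<Longrightarrow>
     (\<And>i. i \<in> set is \<Longrightarrow> sinh (v i - u) \<noteq> 0) \<Longrightarrow>
     (\<And>i j. i \<in> set is \<Longrightarrow> j \<in> set is \<Longrightarrow> i \<noteq> j \<Longrightarrow> sinh (v i - v j) \<noteq> 0) \<Longrightarrow>
     X u * ((\<Prod>i\<leftarrow>is. B (v i)) * \<Omega>)
     = (ev u * (\<Prod>i\<in>set is. sinh (v i - u + h) / sinh (v i - u))) \<odot> ((\<Prod>i\<leftarrow>is. B (v i)) * \<Omega>)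
       - (\<Sum>i\<in>set is. (sinh h / sinh (v i - u) *
           (ev (v i) * (\<Prod>j\<in>set is - {i}. sinh (v j - v i + h) / sinh (v j - v i))))
           \<odot> (B u * ((\<Prod>j\<leftarrow>removeAll i is. B (v j)) * \<Omega>)))"
proof (induction "is" arbitrary: u)
  case Nil
  then show ?case by (simp add: vac)
next
  case (Cons k ys)
  define V where "V = (\<Prod>i\<leftarrow>ys. B (v i)) * \<Omega>"
  define W where "W i = (\<Prod>j\<leftarrow>removeAll i ys. B (v j)) * \<Omega>" for i
  define f where "f x = sinh (x + h) / sinh x" for x
  define g where "g x = sinh h / sinh x" for x
  define q where "q i = ev (v i) * (\<Prod>j\<in>set ys - {i}. f (v j - v i))" for i
  have k: "k \<notin> set ys" and nz: "sinh (v k - u) \<noteq> 0" and G: "v k \<in> G" "u \<in> G"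
    using Cons.prems by auto
  \<comment> \<open>\<open>X u\<close> passing \<open>B (v k)\<close> leaves terms with
    \<open>X u\<close> and with \<open>X (v k)\<close>, so the induction hypothesis is needed at
    both parameters.\<close>
  have IH: "X x * V = (ev x * (\<Prod>i\<in>set ys. f (v i - x))) \<odot> V
      - (\<Sum>i\<in>set ys. (g (v i - x) * q i) \<odot> (B x * W i))" if "x \<in> {u, v k}" for x
    unfolding V_def W_def f_def g_def q_def
    using Cons.prems that k by (intro Cons.IH) auto
  have XB': "X u * B (v k) = f (v k - u) \<odot> (B (v k) * X u) - g (v k - u) \<odot> (B u * X (v k))"
  proof -
    have "X u * B (v k) = (1 / sinh (v k - u)) \<odot> (sinh (v k - u) \<odot> (X u * B (v k)))"
      using nz by simp
    also have "\<dots> = f (v k - u) \<odot> (B (v k) * X u) - g (v k - u) \<odot> (B u * X (v k))"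
      unfolding XB[OF G(2,1)] by (simp add: f_def g_def scale_right_diff_distrib)
    finally show ?thesis .
  qed
  have swap: "B (v k) * (B u * z) = B u * (B (v k) * z)" for z
    using BB[OF G] by (simp flip: mult.assoc)
  have coeff: "f (v k - u) * g (v i - u) - g (v k - u) * g (v i - v k)
      = g (v i - u) * f (v k - v i)" if "i \<in> set ys" for i
    unfolding f_def g_def using Cons.prems that k by (intro bethe_coeff_identity) auto
  \<comment> \<open>The unwanted term of k itself comes from the wanted term of
    \<open>X (v k)\<close>, whose coefficient is \<open>q k\<close>.\<close>
  have q_k: "q k = ev (v k) * (\<Prod>i\<in>set ys. f (v i - v k))"
    using k by (simp add: q_def)
  have rem: "removeAll k ys = ys" using k by simp
  have "X u * (B (v k) * V)
      = f (v k - u) \<odot> (B (v k) * (X u * V)) - g (v k - u) \<odot> (B u * (X (v k) * V))"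
    by (simp add: XB' left_diff_distrib scale_mult_left flip: mult.assoc)
  also have "\<dots> = (f (v k - u) * (ev u * (\<Prod>i\<in>set ys. f (v i - u)))) \<odot> (B (v k) * V)
      - (g (v k - u) * q k) \<odot> (B u * V)
      - ((\<Sum>i\<in>set ys. (f (v k - u) * (g (v i - u) * q i)) \<odot> (B u * (B (v k) * W i)))
         - (\<Sum>i\<in>set ys. (g (v k - u) * (g (v i - v k) * q i)) \<odot> (B u * (B (v k) * W i))))"
    by (simp add: IH q_k right_diff_distrib scale_mult_right scale_right_diff_distrib
        sum_distrib_left scale_sum_right swap algebra_simps)
  also have "(\<Sum>i\<in>set ys. (f (v k - u) * (g (v i - u) * q i)) \<odot> (B u * (B (v k) * W i)))
         - (\<Sum>i\<in>set ys. (g (v k - u) * (g (v i - v k) * q i)) \<odot> (B u * (B (v k) * W i)))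
      = (\<Sum>i\<in>set ys. (g (v i - u) * (f (v k - v i) * q i)) \<odot> (B u * (B (v k) * W i)))"
    unfolding sum_subtractf[symmetric] scale_left_diff_distrib[symmetric]
    by (intro sum.cong refl arg_cong2[where f = scale])
       (simp add: coeff left_diff_distrib[symmetric] mult.assoc[symmetric])
  finally have *: "X u * (B (v k) * V)
      = (ev u * (\<Prod>i\<in>set (k # ys). f (v i - u))) \<odot> (B (v k) * V)
      - ((g (v k - u) * q k) \<odot> (B u * V)
        + (\<Sum>i\<in>set ys. (g (v i - u) * (f (v k - v i) * q i)) \<odot> (B u * (B (v k) * W i))))"
    using k by (simp add: mult_ac algebra_simps)
  have "(\<Sum>i\<in>set (k # ys). (g (v i - u) * (ev (v i) * (\<Prod>j\<in>set (k # ys) - {i}. f (v j - v i))))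
          \<odot> (B u * ((\<Prod>j\<leftarrow>removeAll i (k # ys). B (v j)) * \<Omega>)))
      = (g (v k - u) * q k) \<odot> (B u * V)
        + (\<Sum>i\<in>set ys. (g (v i - u) * (f (v k - v i) * q i)) \<odot> (B u * (B (v k) * W i)))"
  proof -
    have "(\<Prod>j\<in>insert k (set ys) - {i}. f (v j - v i)) = f (v k - v i) * (\<Prod>j\<in>set ys - {i}. f (v j - v i))"
      if "i \<in> set ys" for i
    proof -
      have "insert k (set ys) - {i} = insert k (set ys - {i})" using that k by auto
      then show ?thesis using k by simp
    qed
    moreover have "i \<noteq> k" if "i \<in> set ys" for i using that k by auto
    ultimately show ?thesis
      using k by (simp add: q_def W_def V_def rem mult.assoc mult.left_commute cong: sum.cong)
  qed
  with * show ?case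
    by (simp add: V_def f_def g_def mult.assoc)
qed

end

section \<open>Products over several site parameters, and eigenvectors of the transfer
  matrices\<close>

context spin_chain
begin

text \<open>The induction splits off the last site y of ys. The earlier transfer matrices carry
  their sites to the end by the induction hypothesis with \<open>y # zs\<close> for zs, which leaves
  y at the head, where \<open>tau_cycle\<close> applies.\<close>

lemma tau_prod_cycle:
  "distinct (ys @ zs) \<Longrightarrow> set (ys @ zs) \<subseteq> sites \<Longrightarrow> (\<And>y. y \<in> set ys \<Longrightarrow> reg (ys @ zs) (w y)) \<Longrightarrow>
   reg (ys @ zs) u \<Longrightarrow>
   (\<Prod>y\<leftarrow>ys. tau (ys @ zs) (w y)) * chain (ys @ zs) u a b
   = chain (zs @ ys) u a b * (\<Prod>y\<leftarrow>ys. tau (ys @ zs) (w y))"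
proof (induction ys arbitrary: zs u a b rule: rev_induct)
  case (snoc y ys)
  define U where "U = (\<Prod>y'\<leftarrow>ys. tau (ys @ y # zs) (w y'))"
  have IH: "U * chain (ys @ y # zs) u a b = chain (y # zs @ ys) u a b * U"
    if "reg (ys @ y # zs) u" for u a b
    using snoc.IH[of "y # zs" u a b] snoc.prems that by (simp add: U_def)
  \<comment> \<open>All transfer matrices in the product belong to the original order of the sites;
    moving U across turns this one into that of the order beginning with y.\<close>
  have U_tau: "U * tau (ys @ y # zs) (w y) = tau (y # zs @ ys) (w y) * U"
    using snoc.prems(3)[of y] by (simp add: tau_def sum_distrib_left sum_distrib_right IH)
  have cyc: "tau (y # zs @ ys) (w y) * chain (y # zs @ ys) u a b
      = chain (zs @ ys @ [y]) u a b * tau (y # zs @ ys) (w y)"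
    using tau_cycle[of y "zs @ ys" u a b] snoc.prems(1,2,4) snoc.prems(3)[of y] by auto
  have "U * tau (ys @ y # zs) (w y) * chain (ys @ y # zs) u a b
      = tau (y # zs @ ys) (w y) * (chain (y # zs @ ys) u a b * U)"
    using snoc.prems by (simp add: U_tau mult.assoc IH)
  also have "\<dots> = chain (zs @ ys @ [y]) u a b * (U * tau (ys @ y # zs) (w y))"
    unfolding U_tau by (simp add: mult.assoc[symmetric] cyc del: chain.simps)
  finally show ?case by (simp add: U_def)
qed simp

text \<open>The product U of the earlier transfer matrices stands before the next monodromy entry.
  Carrying U across puts y at the head, where \<open>chain_at_head\<close> splits off the local
  operator; carrying it back restores the original order.\<close>

lemma prod_chain_at_sites:
  "distinct (ys @ zs) \<Longrightarrow> set (ys @ zs) \<subseteq> sites \<Longrightarrow> (\<And>y. y \<in> set ys \<Longrightarrow> reg (ys @ zs) (w y)) \<Longrightarrow>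
   (\<Prod>y\<leftarrow>ys. chain (ys @ zs) (w y) (f y) (g y))
   = (\<Prod>y\<leftarrow>ys. E y (g y) (f y)) * (\<Prod>y\<leftarrow>ys. tau (ys @ zs) (w y))"
proof (induction ys arbitrary: zs rule: rev_induct)
  case (snoc y ys)
  define U where "U = (\<Prod>y'\<leftarrow>ys. tau (ys @ y # zs) (w y'))"
  have IH: "(\<Prod>y'\<leftarrow>ys. chain (ys @ y # zs) (w y') (f y') (g y')) = (\<Prod>y'\<leftarrow>ys. E y' (g y') (f y')) * U"
    using snoc.IH[of "y # zs"] snoc.prems by (simp add: U_def)
  have U: "U * chain (ys @ y # zs) (w y) a b = chain (y # zs @ ys) (w y) a b * U" for a b
    unfolding U_def using tau_prod_cycle[of ys "y # zs" "w y" a b] snoc.prems sinh_eta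
    by (simp del: chain.simps)
  have "U * chain (ys @ y # zs) (w y) (f y) (g y) = E y (g y) (f y) * (tau (y # zs @ ys) (w y) * U)"
    using chain_at_head[of y "zs @ ys" "f y" "g y"] snoc.prems
    by (simp add: U mult.assoc Int_commute del: chain.simps)
  also have "tau (y # zs @ ys) (w y) * U = U * tau (ys @ y # zs) (w y)"
    by (simp add: tau_def sum_distrib_left sum_distrib_right U del: chain.simps)
  finally show ?case by (simp add: U_def[symmetric] IH mult.assoc)
qed simp

text \<open>On the vacuum each \<open>lax\<close> matrix is triangular, so the diagonal entries
  multiply along the chain.\<close>

lemma chain_vacuum:
  assumes "\<And>x. x \<in> set xs \<Longrightarrow> E x False False * \<Omega> = \<Omega>" "distinct xs" "set xs \<subseteq> sites"
  shows "chain xs u False False * \<Omega> = \<Omega> \<and> chain xs u True False * \<Omega> = 0 \<and>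
    chain xs u True True * \<Omega> = (\<Prod>x\<in>set xs. b_fun \<eta> (u - w x)) \<odot> \<Omega>"
  using assms
proof (induction xs)
  case (Cons x xs)
  have x: "x \<in> sites" "x \<notin> set xs" "set xs \<subseteq> sites" using Cons.prems by auto
  have E0: "E x a True * \<Omega> = 0" for a
    using Cons.prems(1)[of x] E_mult[OF x(1), of a True False False]
    by (metis list.set_intros(1) mult.assoc mult_zero_left)
  have IH: "chain xs u False False * \<Omega> = \<Omega>" "chain xs u True False * \<Omega> = 0"
    "chain xs u True True * \<Omega> = (\<Prod>x\<in>set xs. b_fun \<eta> (u - w x)) \<odot> \<Omega>"
    using Cons by auto
  \<comment> \<open>\<open>lax x u False True\<close> need not annihilate the vacuum, since it flips
    site x. Its contribution to the entry \<open>True True\<close> still vanishes: the chain of the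
    other sites commutes with the flip, and its entry \<open>True False\<close> kills the
    vacuum.\<close>
  have c: "chain xs u True False * (E x a b * \<Omega>) = 0" for a b
  proof -
    have "chain xs u True False * E x a b = E x a b * chain xs u True False"
      using chain_commute_E[OF x(3,1,2)] by (simp add: commute_on_def)
    then have "chain xs u True False * (E x a b * \<Omega>) = E x a b * (chain xs u True False * \<Omega>)"
      by (simp flip: mult.assoc)
    then show ?thesis by (simp add: IH)
  qed
  have L: "lax x u False False * \<Omega> = \<Omega>" "lax x u True False * \<Omega> = 0"
    "lax x u True True * \<Omega> = b_fun \<eta> (u - w x) \<odot> \<Omega>"
    "lax x u False True * \<Omega> = c_fun \<eta> (u - w x) \<odot> (E x True False * \<Omega>)"
    using Cons.prems(1)[of x]
    by (simp_all add: lax_def UNIV_bool lax_coeff_def distrib_right scale_mult_left E0)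
  show ?case
    using x by (simp add: aux_mult_def UNIV_bool distrib_right mult.assoc L IH c scale_mult_right mult.commute)
qed (simp add: aux_one_def)

text \<open>The unwanted terms of A and D cancel by the Bethe equations, and the wanted term of D is
  absent at a site parameter, so the eigenvalue comes from A alone.\<close>

lemma bethe_vector_eigen:
  assumes xs: "distinct xs" "set xs \<subseteq> sites" and \<alpha>: "\<alpha> \<in> set xs" "reg xs (w \<alpha>)"
    and vac: "\<And>x. x \<in> set xs \<Longrightarrow> E x False False * \<Omega> = \<Omega>"
    and reg: "\<And>i. i \<in> set is \<Longrightarrow> reg xs (v i)"
    and nz: "\<And>i x. i \<in> set is \<Longrightarrow> x \<in> set xs \<Longrightarrow> sinh (v i - w x) \<noteq> 0"
    and d: "distinct is"
    and nz2: "\<And>i j. i \<in> set is \<Longrightarrow> j \<in> set is \<Longrightarrow> i \<noteq> j \<Longrightarrow>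
        sinh (v i - v j) \<noteq> 0 \<and> sinh (v i - v j - \<eta>) \<noteq> 0"
    and bethe: "\<And>i. i \<in> set is \<Longrightarrow>
        (\<Prod>x\<in>set xs. sinh (v i - w x + \<eta>) / sinh (v i - w x))
        = (\<Prod>j\<in>set is - {i}. sinh (v i - v j + \<eta>) / sinh (v i - v j - \<eta>))"
  shows "tau xs (w \<alpha>) * ((\<Prod>i\<leftarrow>is. chain xs (v i) False True) * \<Omega>)
     = (\<Prod>i\<in>set is. 1 / b_fun \<eta> (v i - w \<alpha>)) \<odot> ((\<Prod>i\<leftarrow>is. chain xs (v i) False True) * \<Omega>)"
proof -
  define A where "A u = chain xs u False False" for u
  define B where "B u = chain xs u False True" for u
  define D where "D u = chain xs u True True" for u
  \<comment> \<open>All spectral parameters that occur; each is regular, so the exchange relations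
    hold between any two of them.\<close>
  define G where "G = insert (w \<alpha>) (v ` set is)"
  define dd where "dd u = (\<Prod>x\<in>set xs. b_fun \<eta> (u - w x))" for u
  have neg: "sinh (x - y) = - sinh (y - x)" "sinh (x - y - \<eta>) = - sinh (y - x + \<eta>)"
    "sinh (x - y + \<eta>) = - sinh (y - x - \<eta>)" for x y
    by (metis minus_diff_eq sinh_minus, metis minus_diff_eq sinh_minus diff_diff_eq2 add.commute diff_add_eq,
        metis minus_diff_eq sinh_minus diff_diff_eq2 add.commute diff_add_eq)
  have regG: "reg xs u" if "u \<in> G" for u
    using that \<alpha> reg by (auto simp: G_def)
  have rtt: "rtt \<eta> (x - y) (chain xs x) (chain xs y)" if "x \<in> G" "y \<in> G" for x y
    using that xs by (intro rtt_chain regG)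
  have AB: "sinh (y - x) \<odot> (A x * B y) = sinh (y - x + \<eta>) \<odot> (B y * A x) - sinh \<eta> \<odot> (B x * A y)"
    if "x \<in> G" "y \<in> G" for x y
    using rtt[OF that(2,1), unfolded rtt_def, rule_format, of False False True False]
    by (simp add: A_def B_def r_diag_def r_flip_def algebra_simps)
  have DB: "sinh (y - x) \<odot> (D x * B y) = sinh (y - x + - \<eta>) \<odot> (B y * D x) - sinh (- \<eta>) \<odot> (B x * D y)"
    if "x \<in> G" "y \<in> G" for x y
  proof -
    have "sinh (x - y + \<eta>) \<odot> (B y * D x) = sinh (x - y) \<odot> (D x * B y) + sinh \<eta> \<odot> (B x * D y)"
      using rtt[OF that, unfolded rtt_def, rule_format, of True False True True]
      by (simp add: D_def B_def r_diag_def r_flip_def)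
    then show ?thesis by (simp add: neg(1)[of y x] neg(2)[of y x])
  qed
  \<comment> \<open>The exchange relation gives \<open>B x * B y = B y * B x\<close> after division
    by \<open>sinh (x - y + \<eta>)\<close>. For \<open>w \<alpha>\<close> and a root this is known
    to be nonzero in one order only; commutation being symmetric, one order suffices.\<close>
  have nzG: "sinh (x - y + \<eta>) \<noteq> 0 \<or> sinh (y - x + \<eta>) \<noteq> 0" if "x \<in> G" "y \<in> G" "x \<noteq> y" for x y
  proof -
    have 1: "sinh (v i - w \<alpha> + \<eta>) \<noteq> 0" if "i \<in> set is" for i
      using reg[OF that] \<alpha> by (auto simp: reg_def)
    have 2: "sinh (v i - v j + \<eta>) \<noteq> 0" if "i \<in> set is" "j \<in> set is" "i \<noteq> j" for i j
      using nz2[of j i] that by (simp add: neg(3))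
    show ?thesis using that 1 2 unfolding G_def by blast
  qed
  have BB': "B x * B y = B y * B x" if "x \<in> G" "y \<in> G" "sinh (x - y + \<eta>) \<noteq> 0" for x y
    using rtt[OF that(1,2), unfolded rtt_def, rule_format, of False False True True] that(3)
    by (simp add: B_def r_diag_def r_flip_def)
  have BB: "B x * B y = B y * B x" if "x \<in> G" "y \<in> G" for x y
    using BB'[OF that] BB'[OF that(2,1)] nzG[OF that] by (cases "x = y") auto
  have vac': "A x * \<Omega> = 1 \<odot> \<Omega>" "D x * \<Omega> = dd x \<odot> \<Omega>" for x
    using chain_vacuum[OF vac xs] by (simp_all add: A_def D_def dd_def)
  have dd0: "dd (w \<alpha>) = 0"
    unfolding dd_def using \<alpha> by (intro prod_zero bexI[of _ \<alpha>]) (auto simp: b_fun_def)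
  define \<Psi> where "\<Psi> = (\<Prod>i\<leftarrow>is. B (v i)) * \<Omega>"
  define W where "W i = B (w \<alpha>) * ((\<Prod>j\<leftarrow>removeAll i is. B (v j)) * \<Omega>)" for i
  have eA: "A (w \<alpha>) * \<Psi> = (\<Prod>i\<in>set is. sinh (v i - w \<alpha> + \<eta>) / sinh (v i - w \<alpha>)) \<odot> \<Psi>
      - (\<Sum>i\<in>set is. (sinh \<eta> / sinh (v i - w \<alpha>) *
           (\<Prod>j\<in>set is - {i}. sinh (v j - v i + \<eta>) / sinh (v j - v i))) \<odot> W i)"
    using bethe_expansion[of G A B \<eta> \<Omega> "\<lambda>_. 1" "is" "w \<alpha>" v] AB BB vac' nz nz2 \<alpha> d
    by (auto simp: \<Psi>_def W_def G_def)
  have eD: "D (w \<alpha>) * \<Psi> = - (\<Sum>i\<in>set is. (sinh (- \<eta>) / sinh (v i - w \<alpha>) *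
           (dd (v i) * (\<Prod>j\<in>set is - {i}. sinh (v j - v i + - \<eta>) / sinh (v j - v i)))) \<odot> W i)"
    using bethe_expansion[of G D B "-\<eta>" \<Omega> dd "is" "w \<alpha>" v] DB BB vac' nz nz2 \<alpha> d
    by (auto simp: \<Psi>_def W_def G_def dd0)
  \<comment> \<open>The Bethe equation inverts \<open>dd (v i)\<close> and so turns the coefficient
    from D into the one from A; the sign of \<open>sinh (- \<eta>)\<close> then makes the two
    unwanted sums opposite.\<close>
  have cancel: "dd (v i) * (\<Prod>j\<in>set is - {i}. sinh (v j - v i + - \<eta>) / sinh (v j - v i))
      = (\<Prod>j\<in>set is - {i}. sinh (v j - v i + \<eta>) / sinh (v j - v i))" if i: "i \<in> set is" for i
  proof -
    have "dd (v i) * (\<Prod>x\<in>set xs. sinh (v i - w x + \<eta>) / sinh (v i - w x)) = 1"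
      unfolding dd_def b_fun_def prod.distrib[symmetric]
      using nz[OF i] reg[OF i] by (intro prod.neutral) (auto simp: reg_def)
    then have 1: "dd (v i) * (\<Prod>j\<in>set is - {i}. sinh (v i - v j + \<eta>) / sinh (v i - v j - \<eta>)) = 1"
      using bethe[OF i] by simp
    have "(\<Prod>j\<in>set is - {i}. sinh (v j - v i + - \<eta>) / sinh (v j - v i))
        = (\<Prod>j\<in>set is - {i}. sinh (v i - v j + \<eta>) / sinh (v i - v j - \<eta>))
        * (\<Prod>j\<in>set is - {i}. sinh (v j - v i + \<eta>) / sinh (v j - v i))"
      unfolding prod.distrib[symmetric]
    proof (intro prod.cong refl)
      fix j assume "j \<in> set is - {i}"
      then have "sinh (v i - v j - \<eta>) \<noteq> 0" "sinh (v j - v i) \<noteq> 0"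
        using nz2[of i j] nz2[of j i] i by auto
      then show "sinh (v j - v i + - \<eta>) / sinh (v j - v i)
         = sinh (v i - v j + \<eta>) / sinh (v i - v j - \<eta>) * (sinh (v j - v i + \<eta>) / sinh (v j - v i))"
        using neg(2)[of "v i" "v j"] neg(3)[of "v i" "v j"] by (simp add: field_simps)
    qed
    then show ?thesis using 1 by simp
  qed
  have "tau xs (w \<alpha>) * \<Psi> = A (w \<alpha>) * \<Psi> + D (w \<alpha>) * \<Psi>"
    by (simp add: tau_def UNIV_bool A_def D_def distrib_right add.commute)
  also have "\<dots> = (\<Prod>i\<in>set is. sinh (v i - w \<alpha> + \<eta>) / sinh (v i - w \<alpha>)) \<odot> \<Psi>"
    unfolding eA eD by (simp add: cancel sum_negf del: add_uminus_conv_diff cong: sum.cong) 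
  finally show ?thesis by (simp add: \<Psi>_def B_def b_fun_def)
qed

end

section \<open>Matrices as endomorphisms\<close>

text \<open>Matrices whose size is a variable are not a type of class \<open>ring_1\<close>; they are embedded into one.\<close>

typedef endo = "{f :: (nat \<Rightarrow> complex) \<Rightarrow> nat \<Rightarrow> complex.
    (\<forall>x y. f (\<lambda>i. x i + y i) = (\<lambda>i. f x i + f y i)) \<and> (\<forall>c x. f (\<lambda>i. c * x i) = (\<lambda>i. c * f x i))}"
  by (rule exI[of _ "\<lambda>_ _. 0"]) simp

setup_lifting type_definition_endo

instantiation endo :: ring_1
begin

lift_definition zero_endo :: endo is "\<lambda>_ _. 0" by simp
lift_definition one_endo :: endo is "\<lambda>x. x" by simp
lift_definition plus_endo :: "endo \<Rightarrow> endo \<Rightarrow> endo" is "\<lambda>f g x i. f x i + g x i"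
  by (simp add: algebra_simps)
lift_definition minus_endo :: "endo \<Rightarrow> endo \<Rightarrow> endo" is "\<lambda>f g x i. f x i - g x i"
  by (simp add: algebra_simps)
lift_definition uminus_endo :: "endo \<Rightarrow> endo" is "\<lambda>f x i. - f x i"
  by (simp add: algebra_simps)
lift_definition times_endo :: "endo \<Rightarrow> endo \<Rightarrow> endo" is "\<lambda>f g x. f (g x)"
  by simp

instance
proof
  show "(0 :: endo) \<noteq> 1"
    by transfer (metis one_neq_zero)
qed (transfer; simp add: algebra_simps fun_eq_iff)+

end

lift_definition endo_scale :: "complex \<Rightarrow> endo \<Rightarrow> endo" is "\<lambda>c f x i. c * f x i"
  by (simp add: algebra_simps)

interpretation endo: complex_algebra endo_scale
  by unfold_locales (transfer; simp add: algebra_simps fun_eq_iff)+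

text \<open>An \<open>n \<times> n\<close> matrix is repeated along the diagonal, so that the unit matrix goes to the
  identity of the infinite-dimensional space.\<close>

lift_definition mat_endo :: "nat \<Rightarrow> complex mat \<Rightarrow> endo" is
  "\<lambda>n A x i. \<Sum>j<n. A $$ (i mod n, j) * x (j + n * (i div n))"
  by (simp add: algebra_simps sum.distrib sum_distrib_left)

lemma endo_eqI: "(\<And>x i. Rep_endo a x i = Rep_endo b x i) \<Longrightarrow> a = b"
  by (rule Rep_endo_inject[THEN iffD1]) (simp add: fun_eq_iff)

lemma mat_endo_mult:
  assumes "A \<in> carrier_mat n n" "B \<in> carrier_mat n n" "n > 0"
  shows "mat_endo n (A * B) = mat_endo n A * mat_endo n B"
proof (rule endo_eqI)
  fix x :: "nat \<Rightarrow> complex" and i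
  have im: "i mod n < n" using assms by simp
  have "(\<Sum>j<n. (A * B) $$ (i mod n, j) * x (j + n * (i div n)))
    = (\<Sum>j<n. \<Sum>k<n. A $$ (i mod n, k) * B $$ (k, j) * x (j + n * (i div n)))"
    using assms im by (intro sum.cong) (auto simp: scalar_prod_def sum_distrib_right lessThan_atLeast0)
  also have "\<dots> = (\<Sum>k<n. A $$ (i mod n, k) * (\<Sum>j<n. B $$ (k, j) * x (j + n * (i div n))))"
    by (subst sum.swap) (simp add: sum_distrib_left mult.assoc)
  finally show "Rep_endo (mat_endo n (A * B)) x i = Rep_endo (mat_endo n A * mat_endo n B) x i"
    by (simp add: mat_endo.rep_eq times_endo.rep_eq)
qed

lemma mat_endo_add:
  assumes "A \<in> carrier_mat n n" "B \<in> carrier_mat n n" "n > 0"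
  shows "mat_endo n (A + B) = mat_endo n A + mat_endo n B"
proof (rule endo_eqI)
  fix x :: "nat \<Rightarrow> complex" and i
  have "(A + B) $$ (i mod n, j) = A $$ (i mod n, j) + B $$ (i mod n, j)" if "j < n" for j
    using assms that by (intro index_add_mat) auto
  then show "Rep_endo (mat_endo n (A + B)) x i = Rep_endo (mat_endo n A + mat_endo n B) x i"
    by (simp add: mat_endo.rep_eq plus_endo.rep_eq distrib_right sum.distrib)
qed

lemma mat_endo_smult:
  assumes "A \<in> carrier_mat n n" "n > 0"
  shows "mat_endo n (c \<cdot>\<^sub>m A) = endo_scale c (mat_endo n A)"
proof (rule endo_eqI)
  fix x :: "nat \<Rightarrow> complex" and i
  have "(c \<cdot>\<^sub>m A) $$ (i mod n, j) = c * A $$ (i mod n, j)" if "j < n" for j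
    using assms that by (intro index_smult_mat) auto
  then show "Rep_endo (mat_endo n (c \<cdot>\<^sub>m A)) x i = Rep_endo (endo_scale c (mat_endo n A)) x i"
    by (simp add: mat_endo.rep_eq endo_scale.rep_eq sum_distrib_left mult.assoc)
qed

lemma mat_endo_one:
  assumes "n > 0"
  shows "mat_endo n (1\<^sub>m n) = 1"
proof (rule endo_eqI)
  fix x :: "nat \<Rightarrow> complex" and i
  have "(\<Sum>j<n. 1\<^sub>m n $$ (i mod n, j) * x (j + n * (i div n)))
      = (\<Sum>j<n. if i mod n = j then x (j + n * (i div n)) else 0)"
    using assms by (intro sum.cong) auto
  also have "\<dots> = x i" using assms by simp
  finally show "Rep_endo (mat_endo n (1\<^sub>m n)) x i = Rep_endo 1 x i"
    by (simp add: mat_endo.rep_eq one_endo.rep_eq)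
qed

lemma mat_endo_zero:
  assumes "n > 0"
  shows "mat_endo n (0\<^sub>m n n) = 0"
  by (rule endo_eqI) (use assms in \<open>simp add: mat_endo.rep_eq zero_endo.rep_eq\<close>)

lemma mat_endo_inject:
  assumes "A \<in> carrier_mat n n" "B \<in> carrier_mat n n" "mat_endo n A = mat_endo n B"
  shows "A = B"
proof (rule eq_matI)
  fix p q assume pq: "p < dim_row B" "q < dim_col B"
  then have lt: "p < n" "q < n" using assms by auto
  \<comment> \<open>Applied to the unit vector at q, the first diagonal block shows column
    q.\<close>
  have "Rep_endo (mat_endo n A) (\<lambda>j. if j = q then 1 else 0) p
      = Rep_endo (mat_endo n B) (\<lambda>j. if j = q then 1 else 0) p"
    by (simp add: assms(3))
  then show "A $$ (p, q) = B $$ (p, q)"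
    using lt by (simp add: mat_endo.rep_eq if_distrib cong: if_cong)
qed (use assms in auto)

section \<open>Matrix units in the binary numbering of the basis\<close>

text \<open>Site j is bit \<open>L - j\<close> of a basis index. An operator at a site changes this
  bit alone, and identities between such changes follow bit by bit.\<close>

definition set_spin :: "nat \<Rightarrow> bool \<Rightarrow> nat \<Rightarrow> nat" where
  "set_spin n b p = (if b then set_bit n p else unset_bit n p)"

lemma bit_set_spin: "bit (set_spin n b p) m \<longleftrightarrow> (if m = n then b else bit p m)"
  by (cases b) (auto simp: set_spin_def bit_set_bit_iff bit_unset_bit_iff)

lemma set_spin_same [simp]: "set_spin n c (set_spin n b p) = set_spin n c p"
  by (rule bit_eqI) (simp add: bit_set_spin)

lemma set_spin_commute: "m \<noteq> n \<Longrightarrow> set_spin m c (set_spin n b p) = set_spin n b (set_spin m c p)"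
  by (rule bit_eqI) (simp add: bit_set_spin)

lemma set_spin_id: "set_spin n (bit p n) p = p"
  by (rule bit_eqI) (simp add: bit_set_spin)

lemma less_power2_iff_bit: "(p :: nat) < 2 ^ L \<longleftrightarrow> (\<forall>m\<ge>L. \<not> bit p m)"
proof
  assume "p < 2 ^ L"
  then have "take_bit L p = p" by (simp add: take_bit_nat_eq_self_iff)
  then show "\<forall>m\<ge>L. \<not> bit p m" by (metis bit_take_bit_iff not_le)
next
  assume h: "\<forall>m\<ge>L. \<not> bit p m"
  have "take_bit L p = p"
  proof (rule bit_eqI)
    fix m show "bit (take_bit L p) m \<longleftrightarrow> bit p m"
      using h by (cases "m < L") (auto simp: bit_take_bit_iff)
  qed
  then show "p < 2 ^ L" by (simp add: take_bit_nat_eq_self_iff)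
qed

lemma set_spin_less: "p < 2 ^ L \<Longrightarrow> n < L \<Longrightarrow> set_spin n b p < 2 ^ L"
  by (auto simp: less_power2_iff_bit bit_set_spin)

lemma spin_eq_bit: "spin L j p = of_bool (bit p (L - j))"
  by (simp add: spin_def bit_iff_odd mod_2_eq_odd)

lemma set_spin_unique:
  assumes "p < 2 ^ L" "q < 2 ^ L" "j \<in> {1..L}"
  shows "(\<forall>k\<in>{1..L} - {j}. spin L k p = spin L k q) \<and> bit q (L - j) = b \<longleftrightarrow> q = set_spin (L - j) b p"
proof
  assume l: "(\<forall>k\<in>{1..L} - {j}. spin L k p = spin L k q) \<and> bit q (L - j) = b"
  show "q = set_spin (L - j) b p"
  proof (rule bit_eqI)
    fix m
    show "bit q m \<longleftrightarrow> bit (set_spin (L - j) b p) m"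
    proof (cases "m < L \<and> m \<noteq> L - j")
      case True
      then have m: "L - m \<in> {1..L} - {j}" "L - (L - m) = m" using assms by auto
      have "spin L (L - m) p = spin L (L - m) q" using l m(1) by blast
      then have "bit p m = bit q m" unfolding spin_eq_bit m(2) of_bool_eq_iff .
      moreover have "m \<noteq> L - j" using True by blast
      ultimately show ?thesis unfolding bit_set_spin by (simp only: if_False)
    next
      case False
      moreover have "\<not> bit p m" "\<not> bit q m" if "L \<le> m"
        using assms(1,2) that unfolding less_power2_iff_bit by blast+
      ultimately show ?thesis using l unfolding bit_set_spin by (cases "m = L - j") auto
    qed
  qed
next
  assume "q = set_spin (L - j) b p"
  moreover have "L - k \<noteq> L - j" if "k \<in> {1..L} - {j}" for k using that assms by auto
  ultimately show "(\<forall>k\<in>{1..L} - {j}. spin L k p = spin L k q) \<and> bit q (L - j) = b"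
    by (simp add: spin_eq_bit bit_set_spin)
qed

lemma mult_mat_index_sum:
  assumes "A \<in> carrier_mat n n" "B \<in> carrier_mat n n" "p < n" "q < n"
  shows "(A * B) $$ (p, q) = (\<Sum>k<n. A $$ (p, k) * B $$ (k, q))"
  using assms by (auto simp: scalar_prod_def lessThan_atLeast0 intro!: sum.cong)

definition site_unit :: "nat \<Rightarrow> nat \<Rightarrow> bool \<Rightarrow> bool \<Rightarrow> complex mat" where
  "site_unit L j a b = site_op L j (elem_mat (of_bool a) (of_bool b))"

lemma site_op_carrier [simp]: "site_op L j X \<in> carrier_mat (2 ^ L) (2 ^ L)"
  by (simp add: site_op_def)

lemma site_unit_carrier [simp]: "site_unit L j a b \<in> carrier_mat (2 ^ L) (2 ^ L)"
  by (simp add: site_unit_def)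

lemma elem_mat_of_bool:
  "elem_mat (of_bool a) (of_bool b) $$ (of_bool c, of_bool d) = (if c = a \<and> d = b then 1 else 0)"
  by (cases a; cases b; cases c; cases d) (simp_all add: elem_mat_def)

lemma site_unit_index:
  assumes "p < 2 ^ L" "q < 2 ^ L" "j \<in> {1..L}"
  shows "site_unit L j a b $$ (p, q) = (if bit p (L - j) = a \<and> q = set_spin (L - j) b p then 1 else 0)"
proof -
  have "site_unit L j a b $$ (p, q) = (if \<forall>k\<in>{1..L} - {j}. spin L k p = spin L k q
      then (if bit p (L - j) = a \<and> bit q (L - j) = b then 1 else 0) else 0)"
    unfolding site_unit_def site_op_def index_mat(1)[OF assms(1,2)] prod.case
      spin_eq_bit[of L j] elem_mat_of_bool ..
  then show ?thesis
    using set_spin_unique[OF assms, of b] by presburger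
qed

text \<open>A row of a matrix unit has at most one nonzero entry, so multiplication by it from the
  left substitutes a row index.\<close>

lemma site_unit_mult_index:
  assumes "p < 2 ^ L" "q < 2 ^ L" "j \<in> {1..L}" "Y \<in> carrier_mat (2 ^ L) (2 ^ L)"
  shows "(site_unit L j a b * Y) $$ (p, q)
       = (if bit p (L - j) = a then Y $$ (set_spin (L - j) b p, q) else 0)"
proof -
  have "(site_unit L j a b * Y) $$ (p, q) = (\<Sum>m<2^L. site_unit L j a b $$ (p, m) * Y $$ (m, q))"
    by (rule mult_mat_index_sum[OF site_unit_carrier assms(4,1,2)])
  also have "\<dots> = (\<Sum>m<2^L. if m = set_spin (L - j) b p then (if bit p (L - j) = a then Y $$ (m, q) else 0) else 0)"
    using assms(1,3) by (intro sum.cong refl) (subst site_unit_index; simp)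
  also have "\<dots> = (if bit p (L - j) = a then Y $$ (set_spin (L - j) b p, q) else 0)"
    using set_spin_less[of p L "L - j" b] assms(1,3) by (simp only: sum.delta finite_lessThan lessThan_iff) auto
  finally show ?thesis .
qed

lemma site_unit_mult:
  assumes j: "j \<in> {1..L}"
  shows "site_unit L j a b * site_unit L j c d = (if b = c then site_unit L j a d else 0\<^sub>m (2 ^ L) (2 ^ L))"
    (is "?M = ?N")
proof (rule eq_matI)
  have N: "?N \<in> carrier_mat (2 ^ L) (2 ^ L)" by simp
  show "dim_row ?M = dim_row ?N" "dim_col ?M = dim_col ?N"
    using N carrier_matD[OF site_unit_carrier] by auto
  fix p q assume "p < dim_row ?N" "q < dim_col ?N"
  then have p: "p < 2 ^ L" and q: "q < 2 ^ L" using N by auto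
  have p': "set_spin (L - j) b p < 2 ^ L" using set_spin_less[OF p] j by simp
  show "?M $$ (p, q) = ?N $$ (p, q)"
    unfolding site_unit_mult_index[OF p q j site_unit_carrier] site_unit_index[OF p' q j]
      bit_set_spin set_spin_same
    by (cases "b = c"; cases "bit p (L - j) = a") (simp_all add: p q site_unit_index[OF p q j])
qed

lemma site_unit_commute:
  assumes j: "j \<in> {1..L}" and k: "k \<in> {1..L}" and "j \<noteq> k"
  shows "site_unit L j a b * site_unit L k c d = site_unit L k c d * site_unit L j a b"
    (is "?M = ?N")
proof (rule eq_matI)
  have ne: "L - j \<noteq> L - k" "L - k \<noteq> L - j" using assms by auto
  show "dim_row ?M = dim_row ?N" "dim_col ?M = dim_col ?N"
    using carrier_matD[OF site_unit_carrier] by auto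
  fix p q assume "p < dim_row ?N" "q < dim_col ?N"
  then have p: "p < 2 ^ L" and q: "q < 2 ^ L"
    using carrier_matD[OF site_unit_carrier] by auto
  have p': "set_spin (L - j) b p < 2 ^ L" "set_spin (L - k) d p < 2 ^ L"
    using set_spin_less[OF p] j k by simp_all
  show "?M $$ (p, q) = ?N $$ (p, q)"
    unfolding site_unit_mult_index[OF p q j site_unit_carrier]
      site_unit_mult_index[OF p q k site_unit_carrier]
      site_unit_index[OF p'(1) q k] site_unit_index[OF p'(2) q j] bit_set_spin
      set_spin_commute[OF ne(1)] if_not_P[OF ne(1)] if_not_P[OF ne(2)]
    by (cases "bit p (L - j) = a"; cases "bit p (L - k) = c") simp_all
qed

section \<open>The monodromy matrix as a chain\<close>

definition endo_unit :: "nat \<Rightarrow> nat \<Rightarrow> bool \<Rightarrow> bool \<Rightarrow> endo" where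
  "endo_unit L j a b = mat_endo (2 ^ L) (site_unit L j a b)"

lemma spin_chain_endo:
  assumes "sinh \<eta> \<noteq> 0"
  shows "spin_chain endo_scale {1..L} (endo_unit L) \<eta>"
proof
  fix j k :: nat and a b c d :: bool
  show "endo_unit L j a b * endo_unit L j c d = (if b = c then endo_unit L j a d else 0)"
    if "j \<in> {1..L}"
    by (simp add: endo_unit_def mat_endo_mult[symmetric] site_unit_mult[OF that] mat_endo_zero)
  show "commute_on (endo_unit L j) (endo_unit L k)" if "j \<in> {1..L}" "k \<in> {1..L}" "j \<noteq> k"
    by (simp add: commute_on_def endo_unit_def mat_endo_mult[symmetric] site_unit_commute[OF that])
qed (rule assms)

lemma elem_mat_carrier [simp]: "elem_mat a b \<in> carrier_mat 2 2"
  by (simp add: elem_mat_def)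

lemma spin_less_2 [simp]: "spin L j p < 2"
  by (simp add: spin_def)

lemma site_op_add:
  assumes "X \<in> carrier_mat 2 2" "Y \<in> carrier_mat 2 2"
  shows "site_op L j (X + Y) = site_op L j X + site_op L j Y"
proof (rule eq_matI)
  fix p q assume "p < dim_row (site_op L j X + site_op L j Y)" "q < dim_col (site_op L j X + site_op L j Y)"
  then have "p < 2 ^ L" "q < 2 ^ L" by (simp_all add: site_op_def)
  moreover have "(X + Y) $$ (spin L j p, spin L j q) = X $$ (spin L j p, spin L j q) + Y $$ (spin L j p, spin L j q)"
    using assms by (intro index_add_mat) auto
  ultimately show "site_op L j (X + Y) $$ (p, q) = (site_op L j X + site_op L j Y) $$ (p, q)"
    by (simp add: site_op_def)
qed (simp_all add: site_op_def)

lemma site_op_smult: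
  assumes "X \<in> carrier_mat 2 2"
  shows "site_op L j (c \<cdot>\<^sub>m X) = c \<cdot>\<^sub>m site_op L j X"
proof (rule eq_matI)
  fix p q assume "p < dim_row (c \<cdot>\<^sub>m site_op L j X)" "q < dim_col (c \<cdot>\<^sub>m site_op L j X)"
  then have "p < 2 ^ L" "q < 2 ^ L" by (simp_all add: site_op_def)
  moreover have "(c \<cdot>\<^sub>m X) $$ (spin L j p, spin L j q) = c * X $$ (spin L j p, spin L j q)"
    using assms by (intro index_smult_mat) auto
  ultimately show "site_op L j (c \<cdot>\<^sub>m X) $$ (p, q) = (c \<cdot>\<^sub>m site_op L j X) $$ (p, q)"
    by (simp add: site_op_def)
qed (simp_all add: site_op_def)

lemma mat_endo_R_entry:
  "mat_endo (2 ^ L) (site_op L j (R_entry \<eta> u (of_bool a) (of_bool a')))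
   = (\<Sum>p\<in>UNIV. \<Sum>q\<in>UNIV. endo_scale (lax_coeff \<eta> u a a' p q) (endo_unit L j p q))"
  by (cases a; cases a')
    (simp_all add: R_entry_def sigma_minus_def sigma_plus_def site_op_add site_op_smult mat_endo_add
      mat_endo_smult UNIV_bool lax_coeff_def endo_unit_def site_unit_def)

lemma partial_monodromy_carrier [simp]:
  "partial_monodromy L \<eta> w u k a a' \<in> carrier_mat (2 ^ L) (2 ^ L)"
  by (induction k arbitrary: a) (auto intro!: add_carrier_mat mult_carrier_mat[of _ "2 ^ L" "2 ^ L"])

lemma monodromy_carrier [simp]: "monodromy L \<eta> w u a a' \<in> carrier_mat (2 ^ L) (2 ^ L)"
  by (simp add: monodromy_def)

text \<open>Each recursion step multiplies from the left and the head of the list is the rightmost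
  factor; hence the sites appear in ascending order.\<close>

lemma mat_endo_partial_monodromy:
  assumes "sinh \<eta> \<noteq> 0"
  shows "mat_endo (2 ^ L) (partial_monodromy L \<eta> w u k (of_bool a) (of_bool a'))
    = spin_chain.chain endo_scale (endo_unit L) \<eta> w [1..<Suc k] u a a'"
proof -
  interpret spin_chain endo_scale "{1..L}" "endo_unit L" \<eta> w
    by (rule spin_chain_endo[OF assms])
  \<comment> \<open>The index 1 is written \<open>Suc 0\<close>, the form that simplification gives
    to \<open>of_bool True\<close>.\<close>
  have R: "mat_endo (2 ^ L) (site_op L j (R_entry \<eta> (u - w j) 0 0)) = lax j u False False"
    "mat_endo (2 ^ L) (site_op L j (R_entry \<eta> (u - w j) (Suc 0) 0)) = lax j u True False"
    "mat_endo (2 ^ L) (site_op L j (R_entry \<eta> (u - w j) 0 (Suc 0))) = lax j u False True"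
    "mat_endo (2 ^ L) (site_op L j (R_entry \<eta> (u - w j) (Suc 0) (Suc 0))) = lax j u True True" for j
    using mat_endo_R_entry[of L j \<eta> "u - w j" False False] mat_endo_R_entry[of L j \<eta> "u - w j" True False]
      mat_endo_R_entry[of L j \<eta> "u - w j" False True] mat_endo_R_entry[of L j \<eta> "u - w j" True True]
    unfolding lax_def by simp_all
  show ?thesis
  proof (induction k arbitrary: a)
    case 0
    then show ?case by (cases a; cases a') (simp_all add: aux_one_def mat_endo_one mat_endo_zero)
  next
    case (Suc k)
    have IH: "mat_endo (2 ^ L) (partial_monodromy L \<eta> w u k 0 (of_bool a')) = chain [1..<Suc k] u False a'"
      "mat_endo (2 ^ L) (partial_monodromy L \<eta> w u k (Suc 0) (of_bool a')) = chain [1..<Suc k] u True a'"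
      using Suc.IH[of False] Suc.IH[of True] by simp_all
    have "chain [1..<Suc (Suc k)] u = aux_mult (lax (Suc k) u) (chain [1..<Suc k] u)"
      using chain_append[of "[1..<Suc k]" "[Suc k]" u] by simp
    then show ?case
      by (cases a) (simp_all add: mat_endo_add mat_endo_mult mult_carrier_mat[of _ "2 ^ L" "2 ^ L"] R IH aux_mult_def UNIV_bool add.commute
          del: upt_Suc)
  qed
qed

lemma prod_list_eigen:
  assumes "\<And>y. y \<in> set ys \<Longrightarrow> T y * x = endo_scale (c y) x"
  shows "(\<Prod>y\<leftarrow>ys. T y) * x = endo_scale (\<Prod>y\<leftarrow>ys. c y) x"
  using assms by (induction ys) (simp_all add: mult.assoc endo.scale_mult_right mult.commute)

section \<open>Vacuum expectation values\<close>

text \<open>The projector onto the vacuum, which serves as the element \<open>\<Omega>\<close>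
  generating the left ideal of Bethe vectors.\<close>

definition vacuum_mat :: "nat \<Rightarrow> complex mat" where
  "vacuum_mat L = mat (2 ^ L) (2 ^ L) (\<lambda>(p, q). if p = 0 \<and> q = 0 then 1 else 0)"

lemma vacuum_mat_carrier [simp]: "vacuum_mat L \<in> carrier_mat (2 ^ L) (2 ^ L)"
  by (simp add: vacuum_mat_def)

lemma site_unit_vacuum:
  assumes "j \<in> {1..L}"
  shows "site_unit L j False False * vacuum_mat L = vacuum_mat L" (is "?M = ?N")
proof (rule eq_matI)
  show "dim_row ?M = dim_row ?N" "dim_col ?M = dim_col ?N"
    using carrier_matD[OF site_unit_carrier] carrier_matD[OF vacuum_mat_carrier] by auto
  fix p q assume "p < dim_row ?N" "q < dim_col ?N"
  then have p: "p < 2 ^ L" and q: "q < 2 ^ L" by (auto simp: vacuum_mat_def)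
  show "?M $$ (p, q) = ?N $$ (p, q)"
    unfolding site_unit_mult_index[OF p q assms vacuum_mat_carrier]
  proof (cases "bit p (L - j)")
    case True
    then have "p \<noteq> 0" by (intro notI) simp
    with True p q show "(if bit p (L - j) = False then vacuum_mat L $$ (set_spin (L - j) False p, q) else 0)
        = vacuum_mat L $$ (p, q)"
      by (simp add: vacuum_mat_def)
  next
    case False
    then show "(if bit p (L - j) = False then vacuum_mat L $$ (set_spin (L - j) False p, q) else 0)
        = vacuum_mat L $$ (p, q)"
      using set_spin_id[of "L - j" p] by simp
  qed
qed

lemma vev_eq:
  assumes "X \<in> carrier_mat (2 ^ L) (2 ^ L)"
  shows "vev L X = X $$ (0, 0)"
proof -
  have "vev L X = (X *\<^sub>v vacuum L) $ 0"
    using assms unfolding vev_def vacuum_def by (intro scalar_prod_left_unit) auto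
  also have "\<dots> = row X 0 \<bullet> unit_vec (2 ^ L) 0"
    using assms unfolding vacuum_def by (intro index_mult_mat_vec) auto
  also have "\<dots> = X $$ (0, 0)"
    using assms by (subst scalar_prod_right_unit[of _ "2 ^ L"]) auto
  finally show ?thesis .
qed

lemma vev_vacuum_mat:
  assumes X: "X \<in> carrier_mat (2 ^ L) (2 ^ L)"
  shows "vev L X = (X * vacuum_mat L) $$ (0, 0)"
proof -
  have "col (vacuum_mat L) 0 = unit_vec (2 ^ L) 0"
    by (rule eq_vecI) (auto simp: vacuum_mat_def unit_vec_def)
  then have "(X * vacuum_mat L) $$ (0, 0) = row X 0 \<bullet> unit_vec (2 ^ L) 0"
    using X carrier_matD[OF vacuum_mat_carrier] by (subst index_mult_mat) auto
  also have "\<dots> = X $$ (0, 0)"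
    using X by (subst scalar_prod_right_unit[of _ "2 ^ L"]) auto
  finally show ?thesis using vev_eq[OF X] by simp
qed

lemma foldr_mult_carrier:
  "(\<And>k. k \<in> set ks \<Longrightarrow> X k \<in> carrier_mat n n) \<Longrightarrow>
   foldr (*) (map X ks) (1\<^sub>m n) \<in> carrier_mat n n"
  by (induction ks) (auto intro!: mult_carrier_mat[of _ n n])

lemma op_prod_carrier [simp]:
  "(\<And>k. X k \<in> carrier_mat (2 ^ L) (2 ^ L)) \<Longrightarrow> op_prod L m X \<in> carrier_mat (2 ^ L) (2 ^ L)"
  unfolding op_prod_def by (rule foldr_mult_carrier)

lemma mat_endo_op_prod:
  assumes "\<And>k. X k \<in> carrier_mat (2 ^ L) (2 ^ L)"
  shows "mat_endo (2 ^ L) (op_prod L m X) = (\<Prod>k\<leftarrow>[1..<Suc m]. mat_endo (2 ^ L) (X k))"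
proof -
  have "mat_endo (2 ^ L) (foldr (*) (map X ks) (1\<^sub>m (2 ^ L))) = (\<Prod>k\<leftarrow>ks. mat_endo (2 ^ L) (X k))" for ks
    using assms by (induction ks) (simp_all add: mat_endo_one mat_endo_mult foldr_mult_carrier)
  then show ?thesis by (simp only: op_prod_def)
qed

text \<open>The identity at regular parameters, without any limit. It already holds for the
  operators applied to the Bethe vector, so an arbitrary matrix C may stand on the left.\<close>

lemma vev_monodromy_at_sites:
  assumes eta: "sinh \<eta> \<noteq> 0" and lL: "l \<le> L"
    and reg_w: "\<And>\<alpha>. \<alpha> \<in> {1..l} \<Longrightarrow> regular_at L \<eta> w (w \<alpha>)"
    and reg_v: "\<And>\<gamma>. \<gamma> \<in> {1..M} \<Longrightarrow> regular_at L \<eta> w (v \<gamma>)"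
    and bethe: "bethe_roots L \<eta> w M v"
    and e: "\<And>\<alpha>. \<alpha> \<in> {1..l} \<Longrightarrow> e \<alpha> \<in> {0, 1} \<and> e' \<alpha> \<in> {0, 1}"
    and C: "C \<in> carrier_mat (2 ^ L) (2 ^ L)"
  shows "vev L (C * op_prod L l (\<lambda>\<alpha>. site_op L \<alpha> (elem_mat (e' \<alpha>) (e \<alpha>)))
           * op_prod L M (\<lambda>\<gamma>. monodromy L \<eta> w (v \<gamma>) 0 1))
       = phi \<eta> l M v w * vev L (C * op_prod L l (\<lambda>\<alpha>. monodromy L \<eta> w (w \<alpha>) (e \<alpha>) (e' \<alpha>))
           * op_prod L M (\<lambda>\<gamma>. monodromy L \<eta> w (v \<gamma>) 0 1))"
proof -
  interpret spin_chain endo_scale "{1..L}" "endo_unit L" \<eta> w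
    by (rule spin_chain_endo[OF eta])
  define n :: nat where "n = 2 ^ L"
  define xs where "xs = [1..<Suc L]"
  define ys where "ys = [1..<Suc l]"
  define gs where "gs = [1..<Suc M]"
  have sets: "set xs = {1..L}" "set ys = {1..l}" "set gs = {1..M}" "distinct xs" "distinct gs" "distinct ys"
    by (auto simp: xs_def ys_def gs_def)
  have xs_split: "xs = ys @ [Suc l..<Suc L]"
    unfolding xs_def ys_def using lL upt_add_eq_append[of 1 "Suc l" "L - l"] by simp
  define \<Omega> where "\<Omega> = mat_endo n (vacuum_mat L)"
  define \<Psi> where "\<Psi> = (\<Prod>i\<leftarrow>gs. chain xs (v i) False True) * \<Omega>"
  define TP where "TP = op_prod L l (\<lambda>\<alpha>. monodromy L \<eta> w (w \<alpha>) (e \<alpha>) (e' \<alpha>))"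
  define EP where "EP = op_prod L l (\<lambda>\<alpha>. site_op L \<alpha> (elem_mat (e' \<alpha>) (e \<alpha>)))"
  define BP where "BP = op_prod L M (\<lambda>\<gamma>. monodromy L \<eta> w (v \<gamma>) 0 1)"
  have car: "TP \<in> carrier_mat n n" "EP \<in> carrier_mat n n" "BP \<in> carrier_mat n n"
    "vacuum_mat L \<in> carrier_mat n n" "C \<in> carrier_mat n n"
    using C by (simp_all add: TP_def EP_def BP_def n_def)
  have n: "n > 0" by (simp add: n_def)
  have bits: "e \<alpha> = of_bool (e \<alpha> = 1)" "e' \<alpha> = of_bool (e' \<alpha> = 1)" if "\<alpha> \<in> {1..l}" for \<alpha>
    using e[OF that] by auto
  have mono: "mat_endo n (monodromy L \<eta> w u (of_bool a) (of_bool b)) = chain xs u a b" for u a b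
    unfolding n_def monodromy_def xs_def by (rule mat_endo_partial_monodromy[OF eta])
  have TP: "mat_endo n TP = (\<Prod>y\<leftarrow>ys. chain xs (w y) (e y = 1) (e' y = 1))"
  proof -
    have "mat_endo n TP = (\<Prod>y\<leftarrow>ys. mat_endo n (monodromy L \<eta> w (w y) (e y) (e' y)))"
      unfolding TP_def n_def ys_def by (rule mat_endo_op_prod) simp
    also have "\<dots> = (\<Prod>y\<leftarrow>ys. chain xs (w y) (e y = 1) (e' y = 1))"
      using mono bits sets by (intro arg_cong[where f = prod_list] map_cong refl) metis
    finally show ?thesis .
  qed
  have EP: "mat_endo n EP = (\<Prod>y\<leftarrow>ys. endo_unit L y (e' y = 1) (e y = 1))"
  proof -
    have "mat_endo n EP = (\<Prod>y\<leftarrow>ys. mat_endo n (site_op L y (elem_mat (e' y) (e y))))"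
      unfolding EP_def n_def ys_def by (rule mat_endo_op_prod) simp
    also have "\<dots> = (\<Prod>y\<leftarrow>ys. endo_unit L y (e' y = 1) (e y = 1))"
      using bits sets unfolding endo_unit_def site_unit_def n_def
      by (intro arg_cong[where f = prod_list] map_cong refl) metis
    finally show ?thesis .
  qed
  have BP: "mat_endo n (BP * vacuum_mat L) = \<Psi>"
  proof -
    have "mat_endo n BP = (\<Prod>i\<leftarrow>gs. mat_endo n (monodromy L \<eta> w (v i) 0 1))"
      unfolding BP_def n_def gs_def by (rule mat_endo_op_prod) simp
    also have "\<dots> = (\<Prod>i\<leftarrow>gs. chain xs (v i) False True)"
      using mono[of _ False True] by simp
    finally show ?thesis
      by (simp add: mat_endo_mult[OF car(3,4) n] \<Psi>_def \<Omega>_def)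
  qed
  have reg_iff: "reg xs u \<longleftrightarrow> regular_at L \<eta> w u" for u
    by (simp add: reg_def regular_at_def sets)
  have vac: "endo_unit L x False False * \<Omega> = \<Omega>" if "x \<in> set xs" for x
    using site_unit_vacuum[of x L] that sets
    by (simp add: endo_unit_def \<Omega>_def n_def mat_endo_mult[symmetric])
  have eig: "tau xs (w y) * \<Psi> = endo_scale (\<Prod>i\<in>set gs. 1 / b_fun \<eta> (v i - w y)) \<Psi>"
    if "y \<in> set ys" for y
    unfolding \<Psi>_def
  proof (rule bethe_vector_eigen)
    show "y \<in> set xs" using that lL by (simp add: sets)
    show "reg xs (w y)" using reg_w that by (simp add: reg_iff sets)
  qed (use bethe reg_v vac reg_iff sets in \<open>auto simp: bethe_roots_def\<close>)
  have "mat_endo n TP * \<Psi> = mat_endo n EP * ((\<Prod>y\<leftarrow>ys. tau xs (w y)) * \<Psi>)"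
    unfolding TP EP mult.assoc[symmetric]
    using prod_chain_at_sites[of ys "[Suc l..<Suc L]" "\<lambda>y. e y = 1" "\<lambda>y. e' y = 1", folded xs_split]
      reg_w sets by (simp add: reg_iff)
  also have "(\<Prod>y\<leftarrow>ys. tau xs (w y)) * \<Psi>
      = endo_scale (\<Prod>y\<leftarrow>ys. \<Prod>i\<in>set gs. 1 / b_fun \<eta> (v i - w y)) \<Psi>"
    by (rule prod_list_eigen) (rule eig)
  also have "(\<Prod>y\<leftarrow>ys. \<Prod>i\<in>set gs. 1 / b_fun \<eta> (v i - w y)) = inverse (phi \<eta> l M v w)"
    unfolding phi_def sets prod.distinct_set_conv_list[OF sets(6), symmetric]
    by (simp add: prod_dividef divide_inverse prod_inversef[symmetric] comp_def)
  finally have "mat_endo n TP * \<Psi> = endo_scale (inverse (phi \<eta> l M v w)) (mat_endo n EP * \<Psi>)"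
    by (simp add: endo.scale_mult_right)
  \<comment> \<open>The numerators are nonzero by the nondegeneracy in \<open>bethe_roots\<close>,
    the denominators by regularity at the roots; so the eigenvalue
    \<open>inverse (phi \<eta> l M v w)\<close> can be moved to the other side.\<close>
  moreover have phi: "phi \<eta> l M v w \<noteq> 0"
    using bethe reg_v lL by (auto simp: phi_def b_fun_def bethe_roots_def regular_at_def)
  ultimately have "mat_endo n (phi \<eta> l M v w \<cdot>\<^sub>m (TP * (BP * vacuum_mat L)))
      = mat_endo n (EP * (BP * vacuum_mat L))"
    using car n by (simp add: mat_endo_mult mat_endo_smult mult_carrier_mat[of _ n n] BP)
  then have eq: "EP * (BP * vacuum_mat L) = phi \<eta> l M v w \<cdot>\<^sub>m (TP * (BP * vacuum_mat L))"
    using car by (intro mat_endo_inject[of _ n]) (auto intro!: mult_carrier_mat[of _ n n])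
  have assoc: "vev L (C * X * BP) = (C * (X * (BP * vacuum_mat L))) $$ (0, 0)" if "X \<in> carrier_mat n n" for X
  proof -
    have "vev L (C * X * BP) = (C * X * BP * vacuum_mat L) $$ (0, 0)"
      using car that by (intro vev_vacuum_mat) (auto simp: n_def intro!: mult_carrier_mat[of _ "2 ^ L" "2 ^ L"])
    also have "C * X * BP * vacuum_mat L = C * (X * (BP * vacuum_mat L))"
      using car that by (simp add: assoc_mult_mat[of _ n n _ n _ n] mult_carrier_mat[of _ n n])
    finally show ?thesis .
  qed
  have "vev L (C * EP * BP) = (phi \<eta> l M v w \<cdot>\<^sub>m (C * (TP * (BP * vacuum_mat L)))) $$ (0, 0)"
    unfolding assoc[OF car(2)] eq using car
    by (subst mult_smult_distrib[of _ n n _ n]) (auto intro!: mult_carrier_mat[of _ n n])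
  also have "\<dots> = phi \<eta> l M v w * vev L (C * TP * BP)"
    unfolding assoc[OF car(1)] using car n
    by (intro index_smult_mat) (auto simp: mult_carrier_mat[of _ n n])
  finally show ?thesis by (simp only: TP_def EP_def BP_def)
qed

section \<open>The limit of complete strings\<close>

definition mat_tendsto :: "nat \<Rightarrow> ('a \<Rightarrow> complex mat) \<Rightarrow> complex mat \<Rightarrow> 'a filter \<Rightarrow> bool" where
  "mat_tendsto n F A \<F> \<longleftrightarrow> (\<forall>p<n. \<forall>q<n. ((\<lambda>x. F x $$ (p, q)) \<longlongrightarrow> A $$ (p, q)) \<F>)"

lemma mat_tendsto_const: "mat_tendsto n (\<lambda>_. A) A \<F>"
  by (simp add: mat_tendsto_def)

lemma mat_tendsto_add:
  assumes "mat_tendsto n F A \<F>" "mat_tendsto n G B \<F>"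
    and "\<And>x. G x \<in> carrier_mat n n" "B \<in> carrier_mat n n"
  shows "mat_tendsto n (\<lambda>x. F x + G x) (A + B) \<F>"
  unfolding mat_tendsto_def
proof (intro allI impI)
  fix p q assume "p < n" "q < n"
  moreover have "dim_row (G x) = n" "dim_col (G x) = n" for x using assms(3)[of x] by auto
  ultimately show "((\<lambda>x. (F x + G x) $$ (p, q)) \<longlongrightarrow> (A + B) $$ (p, q)) \<F>"
    using assms(1,2,4) by (auto simp: mat_tendsto_def intro!: tendsto_add)
qed

lemma mat_tendsto_mult:
  assumes "mat_tendsto n F A \<F>" "mat_tendsto n G B \<F>"
    and "\<And>x. F x \<in> carrier_mat n n" "A \<in> carrier_mat n n"
    and "\<And>x. G x \<in> carrier_mat n n" "B \<in> carrier_mat n n"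
  shows "mat_tendsto n (\<lambda>x. F x * G x) (A * B) \<F>"
  using assms(1,2) unfolding mat_tendsto_def
  by (auto simp: mult_mat_index_sum[OF assms(3,5)] mult_mat_index_sum[OF assms(4,6)]
      intro!: tendsto_sum tendsto_mult)

lemma mat_tendsto_foldr_mult:
  assumes "\<And>k. k \<in> set ks \<Longrightarrow> mat_tendsto n (F k) (A k) \<F>"
    and "\<And>k x. F k x \<in> carrier_mat n n" "\<And>k. A k \<in> carrier_mat n n"
  shows "mat_tendsto n (\<lambda>x. foldr (*) (map (\<lambda>k. F k x) ks) (1\<^sub>m n)) (foldr (*) (map A ks) (1\<^sub>m n)) \<F>"
  using assms(1)
proof (induction ks)
  case (Cons k ks)
  have "foldr (*) (map (\<lambda>k. F k x) ks) (1\<^sub>m n) \<in> carrier_mat n n"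
    "foldr (*) (map A ks) (1\<^sub>m n) \<in> carrier_mat n n" for x
    using assms(2,3) by (induction ks) (auto intro!: mult_carrier_mat[of _ n n])
  with Cons show ?case using assms(2,3) by (auto intro!: mat_tendsto_mult)
qed (simp add: mat_tendsto_const)

lemma mat_tendsto_site_op:
  assumes "mat_tendsto 2 F X \<F>"
  shows "mat_tendsto (2 ^ L) (\<lambda>x. site_op L j (F x)) (site_op L j X) \<F>"
  unfolding mat_tendsto_def
proof (intro allI impI)
  fix p q :: nat assume pq: "p < 2 ^ L" "q < 2 ^ L"
  have "((\<lambda>x. F x $$ (spin L j p, spin L j q)) \<longlongrightarrow> X $$ (spin L j p, spin L j q)) \<F>"
    using assms by (simp add: mat_tendsto_def)
  then have "((\<lambda>x. if P then F x $$ (spin L j p, spin L j q) else 0)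
      \<longlongrightarrow> (if P then X $$ (spin L j p, spin L j q) else 0)) \<F>" for P
    by (cases P) simp_all
  then show "((\<lambda>x. site_op L j (F x) $$ (p, q)) \<longlongrightarrow> site_op L j X $$ (p, q)) \<F>"
    unfolding site_op_def index_mat(1)[OF pq] prod.case .
qed

lemma mat_tendsto_R_entry:
  assumes u: "(f \<longlongrightarrow> u) \<F>" and "sinh (u + \<eta>) \<noteq> 0"
  shows "mat_tendsto 2 (\<lambda>x. R_entry \<eta> (f x) a a') (R_entry \<eta> u a a') \<F>"
proof -
  have "((\<lambda>x. b_fun \<eta> (f x)) \<longlongrightarrow> b_fun \<eta> u) \<F>" "((\<lambda>x. c_fun \<eta> (f x)) \<longlongrightarrow> c_fun \<eta> u) \<F>"
    unfolding b_fun_def c_fun_def using assms by (auto intro!: tendsto_intros)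
  then show ?thesis
    by (auto simp: mat_tendsto_def R_entry_def sigma_minus_def sigma_plus_def elem_mat_def
        intro!: tendsto_intros)
qed

text \<open>Spectral parameter and inhomogeneities move together, as for roots that depend on
  \<epsilon>. Regularity at the limit suffices, since b and c are continuous away from their
  poles.\<close>

lemma mat_tendsto_monodromy:
  assumes u: "(f \<longlongrightarrow> u) \<F>" and w: "\<And>j. ((\<lambda>x. w x j) \<longlongrightarrow> w' j) \<F>"
    and reg: "regular_at L \<eta> w' u"
  shows "mat_tendsto (2 ^ L) (\<lambda>x. monodromy L \<eta> (w x) (f x) a a') (monodromy L \<eta> w' u a a') \<F>"
proof -
  have "mat_tendsto (2 ^ L) (\<lambda>x. partial_monodromy L \<eta> (w x) (f x) k a a')
      (partial_monodromy L \<eta> w' u k a a') \<F>" if "k \<le> L" for k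
    using that
  proof (induction k arbitrary: a)
    case (Suc k)
    have "mat_tendsto 2 (\<lambda>x. R_entry \<eta> (f x - w x (Suc k)) a b) (R_entry \<eta> (u - w' (Suc k)) a b) \<F>" for a b
      using Suc.prems reg by (intro mat_tendsto_R_entry tendsto_diff u w) (simp add: regular_at_def)
    then have R: "mat_tendsto (2 ^ L) (\<lambda>x. site_op L (Suc k) (R_entry \<eta> (f x - w x (Suc k)) a b))
        (site_op L (Suc k) (R_entry \<eta> (u - w' (Suc k)) a b)) \<F>" for a b
      by (rule mat_tendsto_site_op)
    show ?case
      unfolding partial_monodromy.simps
      using Suc by (intro mat_tendsto_add mat_tendsto_mult R Suc.IH site_op_carrier partial_monodromy_carrier
          mult_carrier_mat[of _ "2 ^ L" "2 ^ L"]) simp_all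
  qed (simp add: mat_tendsto_const)
  then show ?thesis by (simp add: monodromy_def)
qed

section \<open>Poles at almost complete strings\<close>

text \<open>The zeros of \<open>sinh\<close> are simple, because \<open>cosh\<close> has square 1
  there; a nonzero shift direction therefore leads away from the zero.\<close>

lemma eventually_sinh_nonzero:
  fixes c d :: complex
  assumes "sinh c \<noteq> 0 \<or> d \<noteq> 0"
  shows "\<forall>\<^sub>F \<epsilon> in at (0::real). sinh (c + of_real \<epsilon> * d) \<noteq> 0"
proof (cases "sinh c = 0")
  case False
  have "((\<lambda>\<epsilon>::real. sinh (c + of_real \<epsilon> * d)) \<longlongrightarrow> sinh (c + of_real 0 * d)) (at 0)"
    by (intro tendsto_intros)
  then show ?thesis using False by (intro tendsto_imp_eventually_ne) auto
next
  case True
  with assms have d: "d \<noteq> 0" by simp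
  have "cosh c \<noteq> 0" using cosh_square_eq[of c] True by auto
  moreover have "(sinh has_field_derivative cosh c) (at c)"
    by (auto intro!: derivative_eq_intros)
  then have "((\<lambda>h. (sinh (c + h) - sinh c) / h) \<longlongrightarrow> cosh c) (at 0)"
    by (simp add: DERIV_def)
  ultimately have "\<forall>\<^sub>F h in at 0. (sinh (c + h) - sinh c) / h \<noteq> 0"
    by (intro tendsto_imp_eventually_ne)
  then have "\<forall>\<^sub>F h in at 0. sinh (c + h) \<noteq> 0"
    by eventually_elim (auto simp: True)
  \<comment> \<open>The derivative argument concerns a punctured neighbourhood, so the shift must
    tend to 0 and also be nonzero.\<close>
  moreover have "filterlim (\<lambda>\<epsilon>::real. of_real \<epsilon> * d) (at 0) (at 0)"
  proof (rule filterlim_atI)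
    have "((\<lambda>\<epsilon>::real. of_real \<epsilon> * d) \<longlongrightarrow> of_real 0 * d) (at 0)"
      by (intro tendsto_intros)
    then show "((\<lambda>\<epsilon>::real. of_real \<epsilon> * d) \<longlongrightarrow> 0) (at 0)" by simp
    show "\<forall>\<^sub>F \<epsilon> in at (0::real). of_real \<epsilon> * d \<noteq> 0"
      using d by (auto simp: eventually_at_filter)
  qed
  ultimately show ?thesis by (rule eventually_compose_filterlim)
qed

lemma string_param_tendsto:
  "((\<lambda>\<epsilon>. string_param l \<eta> \<xi> r \<epsilon> j) \<longlongrightarrow> string_param l \<eta> \<xi> r 0 j) (at 0)"
proof -
  have "((\<lambda>\<epsilon>. \<xi> k - c + of_real \<epsilon> * d) \<longlongrightarrow> \<xi> k - c + of_real 0 * d) (at 0)" for k c d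
    by (intro tendsto_intros)
  then show ?thesis unfolding string_param_def .
qed

text \<open>In a complete string each parameter plus \<eta> equals its predecessor, which is a pole
  of the monodromy matrix. Distinct deviations resolve every such coincidence, within a string or
  between strings.\<close>

lemma eventually_string_regular:
  assumes eta: "sinh \<eta> \<noteq> 0" and inj: "inj_on (\<lambda>(b, \<beta>). r b \<beta>) ({1..Ns} \<times> {1..l})"
    and "1 \<le> Ns" "\<alpha> \<in> {1..l}"
  shows "\<forall>\<^sub>F \<epsilon> in at 0. regular_at (l * Ns) \<eta> (string_param l \<eta> \<xi> r \<epsilon>) (string_param l \<eta> \<xi> r \<epsilon> \<alpha>)"
  unfolding regular_at_def
proof (rule eventually_ball_finite)
  show "\<forall>j\<in>{1..l * Ns}. \<forall>\<^sub>F \<epsilon> in at 0.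
      sinh (string_param l \<eta> \<xi> r \<epsilon> \<alpha> - string_param l \<eta> \<xi> r \<epsilon> j + \<eta>) \<noteq> 0"
  proof
    fix j assume j: "j \<in> {1..l * Ns}"
    \<comment> \<open>The string and the place in it, both counted from 1. Since \<open>pos\<close>
      is injective on the sites, distinct sites have distinct deviations.\<close>
    define pos where "pos j = ((j - 1) div l + 1, (j - 1) mod l + 1)" for j
    define \<rho> where "\<rho> = (\<lambda>(b, \<beta>). r b \<beta>)"
    have l: "l > 0" using assms by auto
    have pos: "pos i \<in> {1..Ns} \<times> {1..l}" if "i \<in> {1..l * Ns}" for i
    proof -
      have "i - 1 < Ns * l" using that by (auto simp: mult.commute)
      then have "(i - 1) div l < Ns" by (rule less_mult_imp_div_less)
      then show ?thesis using l by (simp add: pos_def Suc_le_eq)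
    qed
    have "\<alpha> \<le> l * Ns" using assms(3,4) by (cases Ns) auto
    then have \<alpha>: "\<alpha> \<in> {1..l * Ns}" using assms(4) by simp
    have pos_inj: "i = k" if "pos i = pos k" "i \<in> {1..l * Ns}" "k \<in> {1..l * Ns}" for i k
    proof -
      have "i - 1 = k - 1"
        using that(1) unfolding pos_def by (metis Pair_inject add_right_cancel div_mult_mod_eq)
      then show ?thesis using that by auto
    qed
    \<comment> \<open>The argument of \<open>sinh\<close> is affine in \<epsilon>, with value c at 0
      and slope d.\<close>
    define c where "c = string_param l \<eta> \<xi> r 0 \<alpha> - string_param l \<eta> \<xi> r 0 j + \<eta>"
    define d where "d = \<rho> (pos \<alpha>) - \<rho> (pos j)"
    have "sinh c \<noteq> 0 \<or> d \<noteq> 0"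
    proof (cases "j = \<alpha>")
      case True
      then show ?thesis using eta by (simp add: c_def)
    next
      case False
      then have "pos \<alpha> \<noteq> pos j" using pos_inj \<alpha> j by blast
      then show ?thesis using inj_onD[OF inj[folded \<rho>_def], of "pos \<alpha>" "pos j"] pos \<alpha> j
        by (auto simp: d_def)
    qed
    then have "\<forall>\<^sub>F \<epsilon> in at (0::real). sinh (c + of_real \<epsilon> * d) \<noteq> 0"
      by (rule eventually_sinh_nonzero)
    moreover have "c + of_real \<epsilon> * d = string_param l \<eta> \<xi> r \<epsilon> \<alpha> - string_param l \<eta> \<xi> r \<epsilon> j + \<eta>" for \<epsilon>
      by (simp add: c_def d_def \<rho>_def pos_def string_param_def right_diff_distrib)
    ultimately show "\<forall>\<^sub>F \<epsilon> in at 0. sinh (string_param l \<eta> \<xi> r \<epsilon> \<alpha> - string_param l \<eta> \<xi> r \<epsilon> j + \<eta>) \<noteq> 0"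
      by simp
  qed
qed simp

text \<open>\<open>Lim\<close> is informative only once convergence is known. At a regular parameter
  the entries are continuous at \<epsilon> = 0, so the limit is the value there.\<close>

lemma T_zero_eq:
  assumes "regular_at (l * Ns) \<eta> (string_param l \<eta> \<xi> r 0) u"
  shows "T_zero l Ns \<eta> \<xi> r u a a' = monodromy (l * Ns) \<eta> (string_param l \<eta> \<xi> r 0) u a a'"
proof (rule eq_matI)
  let ?A = "monodromy (l * Ns) \<eta> (string_param l \<eta> \<xi> r 0) u a a'"
  show "dim_row (T_zero l Ns \<eta> \<xi> r u a a') = dim_row ?A" "dim_col (T_zero l Ns \<eta> \<xi> r u a a') = dim_col ?A"
    using carrier_matD[OF monodromy_carrier] by (simp_all add: T_zero_def)
  fix p q assume "p < dim_row ?A" "q < dim_col ?A"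
  then have pq: "p < 2 ^ (l * Ns)" "q < 2 ^ (l * Ns)"
    using carrier_matD[OF monodromy_carrier] by simp_all
  have "mat_tendsto (2 ^ (l * Ns)) (\<lambda>\<epsilon>. T_eps l Ns \<eta> \<xi> r \<epsilon> u a a') ?A (at 0)"
    unfolding T_eps_def
    by (intro mat_tendsto_monodromy string_param_tendsto tendsto_const assms)
  then have "((\<lambda>\<epsilon>. T_eps l Ns \<eta> \<xi> r \<epsilon> u a a' $$ (p, q)) \<longlongrightarrow> ?A $$ (p, q)) (at 0)"
    using pq by (simp add: mat_tendsto_def)
  then have "Lim (at (0::real)) (\<lambda>\<epsilon>. T_eps l Ns \<eta> \<xi> r \<epsilon> u a a' $$ (p, q)) = ?A $$ (p, q)"
    by (intro tendsto_Lim) auto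
  then show "T_zero l Ns \<eta> \<xi> r u a a' $$ (p, q) = ?A $$ (p, q)"
    using pq by (simp add: T_zero_def)
qed

lemma T_eps_carrier [simp]: "T_eps l Ns \<eta> \<xi> r \<epsilon> u a a' \<in> carrier_mat (2 ^ (l * Ns)) (2 ^ (l * Ns))"
  by (simp add: T_eps_def)

text \<open>Convergence is asserted through the witness S instead of the total operator
  \<open>Lim\<close>, because single factors T may have poles in the limit. Generic deviations are
  pairwise distinct ones.\<close>

theorem proposition1p2:
  fixes l Ns M N i1 j1 :: nat
    and \<eta> :: complex
    and \<xi> :: "nat \<Rightarrow> complex"
    and r :: "nat \<Rightarrow> nat \<Rightarrow> complex"
    and \<mu> v :: "nat \<Rightarrow> complex"
    and v_eps :: "real \<Rightarrow> nat \<Rightarrow> complex"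
    and e e' :: "nat \<Rightarrow> nat"
  defines "L \<equiv> l * Ns"
    and "w \<equiv> string_param l \<eta> \<xi> r"
  assumes "1 \<le> l" and "1 \<le> Ns"
    and eta: "sinh \<eta> \<noteq> 0"
    and generic: "inj_on (\<lambda>(b, \<beta>). r b \<beta>) ({1..Ns} \<times> {1..l})"
    and "\<forall>\<alpha>\<in>{1..l}. e \<alpha> \<in> {0, 1} \<and> e' \<alpha> \<in> {0, 1}"
    and "i1 = card {\<alpha>\<in>{1..l}. e' \<alpha> = 1}"
    and "j1 = card {\<beta>\<in>{1..l}. e \<beta> = 1}"
    and "int i1 - int j1 = int N - int M"
    and mu_regular: "\<forall>k\<in>{1..N}. regular_at L \<eta> (w 0) (\<mu> k)"
    and v_regular: "\<forall>\<gamma>\<in>{1..M}. regular_at L \<eta> (w 0) (v \<gamma>)"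
    and bethe: "bethe_roots L \<eta> (w 0) M v"
    and bethe_eps: "\<forall>\<^sub>F \<epsilon> in at 0. bethe_roots L \<eta> (w \<epsilon>) M (v_eps \<epsilon>)"
    and roots_limit: "\<forall>\<gamma>\<in>{1..M}. ((\<lambda>\<epsilon>. v_eps \<epsilon> \<gamma>) \<longlongrightarrow> v \<gamma>) (at 0)"
  shows "\<exists>S. ((\<lambda>\<epsilon>. vev L
                 (op_prod L N (\<lambda>k. C_eps l Ns \<eta> \<xi> r \<epsilon> (\<mu> k))
                  * op_prod L l (\<lambda>\<alpha>. T_eps l Ns \<eta> \<xi> r \<epsilon> (w \<epsilon> \<alpha>) (e \<alpha>) (e' \<alpha>))
                  * op_prod L M (\<lambda>\<gamma>. B_eps l Ns \<eta> \<xi> r \<epsilon> (v_eps \<epsilon> \<gamma>)))) \<longlongrightarrow> S) (at 0)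
           \<and> vev L
                 (op_prod L N (\<lambda>k. C_zero l Ns \<eta> \<xi> r (\<mu> k))
                  * op_prod L l (\<lambda>\<alpha>. site_op L \<alpha> (elem_mat (e' \<alpha>) (e \<alpha>)))
                  * op_prod L M (\<lambda>\<gamma>. B_zero l Ns \<eta> \<xi> r (v \<gamma>)))
             = phi \<eta> l M v (w 0) * S"
proof -
  define n :: nat where "n = 2 ^ L"
  define TP where "TP \<epsilon> = op_prod L l (\<lambda>\<alpha>. T_eps l Ns \<eta> \<xi> r \<epsilon> (w \<epsilon> \<alpha>) (e \<alpha>) (e' \<alpha>))" for \<epsilon>
  define EP where "EP = op_prod L l (\<lambda>\<alpha>. site_op L \<alpha> (elem_mat (e' \<alpha>) (e \<alpha>)))"
  define CP where "CP \<epsilon> = op_prod L N (\<lambda>k. C_eps l Ns \<eta> \<xi> r \<epsilon> (\<mu> k))" for \<epsilon>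
  define BP where "BP \<epsilon> = op_prod L M (\<lambda>\<gamma>. B_eps l Ns \<eta> \<xi> r \<epsilon> (v_eps \<epsilon> \<gamma>))" for \<epsilon>
  define CP0 where "CP0 = op_prod L N (\<lambda>k. monodromy L \<eta> (w 0) (\<mu> k) 1 0)"
  define BP0 where "BP0 = op_prod L M (\<lambda>\<gamma>. monodromy L \<eta> (w 0) (v \<gamma>) 0 1)"
  have T: "T_eps l Ns \<eta> \<xi> r \<epsilon> u a a' = monodromy L \<eta> (w \<epsilon>) u a a'" for \<epsilon> u a a'
    by (simp add: T_eps_def L_def w_def)
  have car: "CP \<epsilon> \<in> carrier_mat n n" "BP \<epsilon> \<in> carrier_mat n n" "CP0 \<in> carrier_mat n n"
    "BP0 \<in> carrier_mat n n" "EP \<in> carrier_mat n n" for \<epsilon>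
    by (simp_all add: CP_def BP_def CP0_def BP0_def EP_def n_def C_eps_def B_eps_def T)
  have w_lim: "((\<lambda>\<epsilon>. w \<epsilon> j) \<longlongrightarrow> w 0 j) (at 0)" for j
    unfolding w_def by (rule string_param_tendsto)
  have lL: "l \<le> L" using \<open>1 \<le> Ns\<close> by (cases Ns) (simp_all add: L_def)
  \<comment> \<open>For l \<ge> 2 this fails at \<epsilon> = 0 itself; \<open>at 0\<close> asks for
    a punctured neighbourhood only.\<close>
  have reg_w: "\<forall>\<^sub>F \<epsilon> in at 0. \<forall>\<alpha>\<in>{1..l}. regular_at L \<eta> (w \<epsilon>) (w \<epsilon> \<alpha>)"
    unfolding L_def w_def
    using eventually_string_regular[OF eta generic \<open>1 \<le> Ns\<close>] by (intro eventually_ball_finite) auto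
  have reg_v: "\<forall>\<^sub>F \<epsilon> in at 0. \<forall>\<gamma>\<in>{1..M}. regular_at L \<eta> (w \<epsilon>) (v_eps \<epsilon> \<gamma>)"
    unfolding regular_at_def
  proof (intro eventually_ball_finite ballI finite_atLeastAtMost)
    fix \<gamma> j assume \<gamma>: "\<gamma> \<in> {1..M}" and j: "j \<in> {1..L}"
    have "((\<lambda>\<epsilon>. sinh (v_eps \<epsilon> \<gamma> - w \<epsilon> j + \<eta>)) \<longlongrightarrow> sinh (v \<gamma> - w 0 j + \<eta>)) (at 0)"
      by (intro tendsto_sinh tendsto_add tendsto_diff tendsto_const w_lim roots_limit[rule_format] \<gamma>)
    then show "\<forall>\<^sub>F \<epsilon> in at 0. sinh (v_eps \<epsilon> \<gamma> - w \<epsilon> j + \<eta>) \<noteq> 0"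
      using v_regular \<gamma> j by (intro tendsto_imp_eventually_ne) (auto simp: regular_at_def)
  qed
  have identity: "\<forall>\<^sub>F \<epsilon> in at 0. vev L (CP \<epsilon> * EP * BP \<epsilon>)
      = phi \<eta> l M (v_eps \<epsilon>) (w \<epsilon>) * vev L (CP \<epsilon> * TP \<epsilon> * BP \<epsilon>)"
    using reg_w reg_v bethe_eps
  proof eventually_elim
    case (elim \<epsilon>)
    show ?case
      unfolding TP_def EP_def BP_def B_eps_def T
    proof (rule vev_monodromy_at_sites[OF eta lL _ _ elim(3) _ car(1)[unfolded n_def]])
      show "regular_at L \<eta> (w \<epsilon>) (w \<epsilon> \<alpha>)" if "\<alpha> \<in> {1..l}" for \<alpha>
        using elim(1) that by blast
      show "regular_at L \<eta> (w \<epsilon>) (v_eps \<epsilon> \<gamma>)" if "\<gamma> \<in> {1..M}" for \<gamma>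
        using elim(2) that by blast
      show "e \<alpha> \<in> {0, 1} \<and> e' \<alpha> \<in> {0, 1}" if "\<alpha> \<in> {1..l}" for \<alpha>
        \<comment> \<open>The two \<open>defines\<close> count as the first members of
          \<open>assms\<close>; number 7 is the condition on e and e'.\<close>
        using assms(7) that by blast
    qed
  qed
  have CP_lim: "mat_tendsto n CP CP0 (at 0)"
    unfolding CP_def CP0_def op_prod_def C_eps_def T n_def
    using mu_regular w_lim
    by (intro mat_tendsto_foldr_mult mat_tendsto_monodromy tendsto_const monodromy_carrier) auto
  have BP_lim: "mat_tendsto n BP BP0 (at 0)"
    unfolding BP_def BP0_def op_prod_def B_eps_def T n_def
    using v_regular roots_limit w_lim
    by (intro mat_tendsto_foldr_mult mat_tendsto_monodromy monodromy_carrier) auto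
  \<comment> \<open>All factors on this side are regular in the limit, which can therefore be taken
    factor by factor.\<close>
  have vev_lim: "((\<lambda>\<epsilon>. vev L (CP \<epsilon> * EP * BP \<epsilon>)) \<longlongrightarrow> vev L (CP0 * EP * BP0)) (at 0)"
  proof -
    have "mat_tendsto n (\<lambda>\<epsilon>. CP \<epsilon> * EP * BP \<epsilon>) (CP0 * EP * BP0) (at 0)"
      by (intro mat_tendsto_mult CP_lim BP_lim mat_tendsto_const car mult_carrier_mat[of _ n n])
    moreover have "CP \<epsilon> * EP * BP \<epsilon> \<in> carrier_mat (2 ^ L) (2 ^ L)"
      "CP0 * EP * BP0 \<in> carrier_mat (2 ^ L) (2 ^ L)" for \<epsilon>
      using car unfolding n_def by (intro mult_carrier_mat[of _ "2 ^ L" "2 ^ L"]; simp)+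
    ultimately show ?thesis by (simp add: vev_eq mat_tendsto_def n_def)
  qed
  have phi_lim: "((\<lambda>\<epsilon>. phi \<eta> l M (v_eps \<epsilon>) (w \<epsilon>)) \<longlongrightarrow> phi \<eta> l M v (w 0)) (at 0)"
    unfolding phi_def b_fun_def
  proof (intro tendsto_prod tendsto_divide tendsto_sinh tendsto_add tendsto_diff tendsto_const w_lim)
    fix j \<gamma> assume "j \<in> {1..l}" and \<gamma>: "\<gamma> \<in> {1..M}"
    then have "j \<in> {1..L}" using lL by simp
    then show "sinh (v \<gamma> - w 0 j + \<eta>) \<noteq> 0"
      using v_regular \<gamma> unfolding regular_at_def by blast
    show "((\<lambda>\<epsilon>. v_eps \<epsilon> \<gamma>) \<longlongrightarrow> v \<gamma>) (at 0)" "((\<lambda>\<epsilon>. v_eps \<epsilon> \<gamma>) \<longlongrightarrow> v \<gamma>) (at 0)"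
      using roots_limit \<gamma> by blast+
  qed
  have phi0: "phi \<eta> l M v (w 0) \<noteq> 0"
    using bethe v_regular lL by (auto simp: phi_def b_fun_def bethe_roots_def regular_at_def)
  \<comment> \<open>The identity is solved for the side with T: its limit exists because the local
    side converges and \<open>phi\<close> tends to a nonzero value.\<close>
  define S where "S = vev L (CP0 * EP * BP0) / phi \<eta> l M v (w 0)"
  have "((\<lambda>\<epsilon>. vev L (CP \<epsilon> * EP * BP \<epsilon>) / phi \<eta> l M (v_eps \<epsilon>) (w \<epsilon>)) \<longlongrightarrow> S) (at 0)"
    unfolding S_def by (intro tendsto_divide vev_lim phi_lim phi0)
  moreover have "\<forall>\<^sub>F \<epsilon> in at 0. vev L (CP \<epsilon> * EP * BP \<epsilon>) / phi \<eta> l M (v_eps \<epsilon>) (w \<epsilon>)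
      = vev L (CP \<epsilon> * TP \<epsilon> * BP \<epsilon>)"
    using identity tendsto_imp_eventually_ne[OF phi_lim phi0] by eventually_elim simp
  ultimately have "((\<lambda>\<epsilon>. vev L (CP \<epsilon> * TP \<epsilon> * BP \<epsilon>)) \<longlongrightarrow> S) (at 0)"
    by (rule Lim_transform_eventually)
  moreover have "op_prod L N (\<lambda>k. C_zero l Ns \<eta> \<xi> r (\<mu> k)) = CP0"
    unfolding op_prod_def CP0_def C_zero_def using mu_regular
    by (intro map_cong refl arg_cong[where f = "\<lambda>xs. foldr (*) xs (1\<^sub>m (2 ^ L))"])
       (auto simp: T_zero_eq L_def w_def)
  moreover have "op_prod L M (\<lambda>\<gamma>. B_zero l Ns \<eta> \<xi> r (v \<gamma>)) = BP0"
    unfolding op_prod_def BP0_def B_zero_def using v_regular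
    by (intro map_cong refl arg_cong[where f = "\<lambda>xs. foldr (*) xs (1\<^sub>m (2 ^ L))"])
       (auto simp: T_zero_eq L_def w_def)
  ultimately show ?thesis
    using phi0 by (intro exI[of _ S]) (simp add: CP_def TP_def BP_def EP_def S_def)
qed

end
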